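(* Let $n\geq 3$ and let $K\subset\mathbb{C}^n$ be a compact rationally convex set. Then the complement $\mathbb{C}^n\setminus K$ is simply connected.
   Context: A compact set $K\subset\mathbb{C}^n$ is rationally convex if for every point $y_0\in\mathbb{C}^n\setminus K$ there exists a non-constant holomorphic polynomial $P:\mathbb{C}^n\to\mathbb{C}$ such that $P(y_0)=1$ and $1\notin P(K)$. Simply connected means that the fundamental group is trivial, i.e. every loop is homotopically trivial; no base point is specified because the complement of a compact rationally convex set in $\mathbb{C}^n$ is arcwise connected for $n\geq 2$. *)

theory Defs
  imports "HOL-Analysis.Analysis"
begin

definition complex_polynomial_function :: "(complex ^ 'n \<Rightarrow> complex) \<Rightarrow> bool" where
  "complex_polynomial_function P \<longleftrightarrow>
     (\<exists>(A :: ('n \<Rightarrow> nat) set) c. finite A \<and>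
        P = (\<lambda>z. \<Sum>\<alpha>\<in>A. c \<alpha> * (\<Prod>i\<in>UNIV. (z $ i) ^ \<alpha> i)))"

definition rationally_convex :: "(complex ^ 'n) set \<Rightarrow> bool" where
  "rationally_convex K \<longleftrightarrow>
     (\<forall>y\<in>- K. \<exists>P. complex_polynomial_function P \<and> \<not> P constant_on UNIV \<and>
        P y = 1 \<and> 1 \<notin> P ` K)"

end

(*
  Fix a base point e outside a large ball.  Homotopy classes of paths to e form the universal
  covering of X = -K, so X is simply connected as soon as this covering has a section over X;
  over the exterior of a large ball there is one, since spheres are simply connected.

  Every point of X lies in a tube T = {|P - 1| < delta} in X.  The function
  psi(z) = (1 + |z|^2) (delta^2 - |P(z) - 1|^2) is positive exactly on T, and at each point of T its
  Levi form is positive on the complex hyperplane ker dP.  For n >= 3 its Hessian is thus positive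
  definite on a real plane, so superlevel sets of psi are locally connected at their boundary, and
  the section extends uniquely when the level is lowered from infinity to 0.

  Sections over two tubes agree: a bounded component of the intersection is excluded by the maximum
  principle for (1 + |z|^2) (delta1^2 - |P1 - 1|^2) (delta2^2 - |P2 - 1|^2), whose Levi form is
  positive on ker dP1 Int ker dP2, nonzero for n >= 3.  Hence they glue to a section over X.
*)

theory Submission
  imports Defs
begin

section \<open>Sections of the universal covering\<close>

text \<open>Loops are never contracted by hand: a locally constant choice of homotopy class of paths
  to \<open>e\<close> behaves like a function, so it can be extended, compared and glued. The
  obstacle is that \<psi> may have degenerate critical points, so neither the Morse lemma nor a
  gradient flow is at hand. The substitute is local: the level can be lowered past x as soon as the
  superlevel set near x is connected, and a real plane on which the Hessian is positive achieves
  this because a circle is connected. The function delta^2 - |P - 1|^2 alone has zero Levi form on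
  ker dP; the factor 1 + |z|^2 supplies the strict sign. Positivity of the Levi form along v still
  only shows that one of v and i v is a direction of positive second derivative. A real plane
  therefore takes two complex directions in ker dP, the second one orthogonal to the first for the
  Hessian. One complex condition for dP and one for orthogonality leave a nonzero vector because n
  >= 3.\<close>

definition path_in :: "'a::topological_space set \<Rightarrow> 'a \<Rightarrow> 'a \<Rightarrow> (real \<Rightarrow> 'a) \<Rightarrow> bool" where
  "path_in X u v p \<longleftrightarrow> path p \<and> path_image p \<subseteq> X \<and> pathstart p = u \<and> pathfinish p = v"

lemma path_in_join: "path_in X u v p \<Longrightarrow> path_in X v w q \<Longrightarrow> path_in X u w (p +++ q)"
  by (auto simp: path_in_def path_image_join)

lemma path_in_reverse: "path_in X u v p \<Longrightarrow> path_in X v u (reversepath p)"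
  by (auto simp: path_in_def)

lemma path_in_linepath:
  fixes u v :: "'a::real_normed_vector"
  shows "path_in X u v (linepath u v) \<longleftrightarrow> closed_segment u v \<subseteq> X"
  by (auto simp: path_in_def)

lemma path_in_mono: "path_in X u v p \<Longrightarrow> X \<subseteq> Y \<Longrightarrow> path_in Y u v p"
  by (auto simp: path_in_def)

section \<open>Cancellation of paths up to homotopy\<close>

lemma homotopic_paths_cancel_rinv:
  fixes p :: "real \<Rightarrow> 'a::real_normed_vector"
  assumes p: "path_in X u v p" and q: "path_in X v w q"
  shows "homotopic_paths X ((p +++ q) +++ reversepath q) p"
proof -
  have "homotopic_paths X ((p +++ q) +++ reversepath q) (p +++ (q +++ reversepath q))"
    using assms by (intro homotopic_paths_sym[OF homotopic_paths_assoc]) (auto simp: path_in_def)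
  also have "homotopic_paths X \<dots> (p +++ linepath v v)"
    using assms homotopic_paths_rinv[of q X]
    by (intro homotopic_paths_join) (auto simp: path_in_def)
  also have "homotopic_paths X \<dots> p"
    using p homotopic_paths_rid[of p X] by (auto simp: path_in_def)
  finally show ?thesis .
qed

lemma homotopic_paths_right_cancel:
  fixes p :: "real \<Rightarrow> 'a::real_normed_vector"
  assumes p: "path_in X u v p" and p': "path_in X u v p'" and q: "path_in X v w q"
    and h: "homotopic_paths X (p +++ q) (p' +++ q)"
  shows "homotopic_paths X p p'"
proof -
  have "homotopic_paths X p ((p +++ q) +++ reversepath q)"
    using homotopic_paths_cancel_rinv[OF p q] homotopic_paths_sym by blast
  also have "homotopic_paths X \<dots> ((p' +++ q) +++ reversepath q)"
    using h q p by (intro homotopic_paths_join[OF h]) (auto simp: path_in_def)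
  also have "homotopic_paths X \<dots> p'"
    using homotopic_paths_cancel_rinv[OF p' q] .
  finally show ?thesis .
qed

lemma homotopic_paths_in_convex:
  fixes p :: "real \<Rightarrow> 'a::real_normed_vector"
  assumes "convex C" "C \<subseteq> X" "path_in C u v p" "path_in C u v q"
  shows "homotopic_paths X p q"
proof (rule homotopic_paths_linear)
  fix t :: real assume "t \<in> {0..1}"
  then have "p t \<in> C" "q t \<in> C"
    using assms by (auto simp: path_in_def path_image_def)
  then show "closed_segment (p t) (q t) \<subseteq> X"
    using assms closed_segment_subset by blast
qed (use assms in \<open>auto simp: path_in_def\<close>)

text \<open>
  A section over \<open>U\<close> is a continuous section of the universal covering of \<open>X\<close>, whose points
  are homotopy classes of paths to the base point \<open>e\<close>.
\<close>

definition path_section :: "'a::real_normed_vector set \<Rightarrow> 'a \<Rightarrow> 'a set \<Rightarrow> ('a \<Rightarrow> real \<Rightarrow> 'a) \<Rightarrow> bool" where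
  "path_section X e U s \<longleftrightarrow> open U \<and> U \<subseteq> X \<and> (\<forall>z\<in>U. path_in X z e (s z)) \<and>
     (\<forall>z\<in>U. \<exists>\<epsilon>>0. ball z \<epsilon> \<subseteq> U \<and> (\<forall>w\<in>ball z \<epsilon>. homotopic_paths X (linepath z w +++ s w) (s z)))"

lemma path_section_path: "path_section X e U s \<Longrightarrow> z \<in> U \<Longrightarrow> path_in X z e (s z)"
  by (simp add: path_section_def)

lemma path_section_refl: "path_section X e U s \<Longrightarrow> z \<in> U \<Longrightarrow> homotopic_paths X (s z) (s z)"
  by (simp add: path_section_def path_in_def)

lemma path_section_subset:
  assumes s: "path_section X e U s" and V: "open V" "V \<subseteq> U"
  shows "path_section X e V s"
  unfolding path_section_def
proof (intro conjI ballI)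
  fix z assume z: "z \<in> V"
  with s V obtain \<epsilon> where \<epsilon>: "\<epsilon> > 0" "\<forall>w\<in>ball z \<epsilon>. homotopic_paths X (linepath z w +++ s w) (s z)"
    unfolding path_section_def by blast
  from V z obtain d where d: "d > 0" "ball z d \<subseteq> V"
    using open_contains_ball by blast
  show "\<exists>\<epsilon>>0. ball z \<epsilon> \<subseteq> V \<and> (\<forall>w\<in>ball z \<epsilon>. homotopic_paths X (linepath z w +++ s w) (s z))"
    using \<epsilon> d by (intro exI[of _ "min \<epsilon> d"]) auto
qed (use assms in \<open>auto simp: path_section_def\<close>)

text \<open>Unique path lifting. The relation \<open>R t u\<close>, transport along \<open>c\<close>
  between the times \<open>t\<close> and \<open>u\<close>, is an equivalence relation on the unit
  interval and holds between neighbouring times, where \<open>c\<close> stays in a ball and can be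
  replaced by a segment. Connectedness of the interval then gives \<open>R 0 1\<close>.\<close>

lemma path_section_transport:
  assumes s: "path_section X e U s" and c: "path_in U a b c"
  shows "homotopic_paths X (c +++ s b) (s a)"
proof -
  define R where "R t u \<longleftrightarrow> homotopic_paths X (subpath t u c +++ s (c u)) (s (c t))" for t u
  have UX: "U \<subseteq> X" using s by (simp add: path_section_def)
  have pc: "path c" and ci: "path_image c \<subseteq> U" using c by (auto simp: path_in_def)
  have cU: "c t \<in> U" if "t \<in> {0..1}" for t
    using that ci by (auto simp: path_image_def)
  have sp: "path_in X (c t) e (s (c t))" if "t \<in> {0..1}" for t
    using path_section_path[OF s cU[OF that]] .
  have subU: "path_in U (c t) (c u) (subpath t u c)" if "t \<in> {0..1}" "u \<in> {0..1}" for t u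
    using that pc ci path_image_subpath_subset[of t u c]
    by (auto simp: path_in_def path_subpath)
  have sub: "path_in X (c t) (c u) (subpath t u c)" if "t \<in> {0..1}" "u \<in> {0..1}" for t u
    using path_in_mono[OF subU[OF that] UX] .
  have R_trans: "R t w" if R: "R t u" "R u w" and I: "t \<in> {0..1}" "u \<in> {0..1}" "w \<in> {0..1}" for t u w
  proof -
    have "homotopic_paths X (subpath t w c +++ s (c w)) ((subpath t u c +++ subpath u w c) +++ s (c w))"
      using I sub sp pc ci UX
      by (intro homotopic_paths_join homotopic_paths_sym[OF homotopic_join_subpaths])
         (auto simp: path_in_def)
    also have "homotopic_paths X \<dots> (subpath t u c +++ (subpath u w c +++ s (c w)))"
      using sub[of t u] sub[of u w] sp[of w] I
      by (intro homotopic_paths_sym[OF homotopic_paths_assoc]) (auto simp: path_in_def)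
    also have "homotopic_paths X \<dots> (subpath t u c +++ s (c u))"
      using sub[of t u] sub[of u w] sp[of w] I R(2)
      by (intro homotopic_paths_join) (auto simp: path_in_def R_def)
    also have "homotopic_paths X \<dots> (s (c t))" using R(1) by (simp add: R_def)
    finally show ?thesis by (simp add: R_def)
  qed
  have R_sym: "R u t" if R: "R t u" and I: "t \<in> {0..1}" "u \<in> {0..1}" for t u
  proof -
    have "homotopic_paths X (subpath u t c +++ s (c t)) (subpath u t c +++ (subpath t u c +++ s (c u)))"
      using R sub[of u t] sub[of t u] sp I
      by (intro homotopic_paths_join) (auto simp: path_in_def R_def homotopic_paths_sym)
    also have "homotopic_paths X \<dots> ((subpath u t c +++ subpath t u c) +++ s (c u))"
      using sub[of t u] sub[of u t] sp[of u] I
      by (intro homotopic_paths_assoc) (auto simp: path_in_def)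
    also have "homotopic_paths X \<dots> (linepath (c u) (c u) +++ s (c u))"
    proof (intro homotopic_paths_join)
      show "homotopic_paths X (subpath u t c +++ subpath t u c) (linepath (c u) (c u))"
        using homotopic_join_subpaths[of c X u t u] I pc ci UX 
        by (auto simp: subpath_refl)
    qed (use sp[of u] sub[of t u] I in \<open>auto simp: path_in_def\<close>)
    also have "homotopic_paths X \<dots> (s (c u))"
      using homotopic_paths_lid[of "s (c u)" X] sp[of u] I by (auto simp: path_in_def)
    finally show ?thesis by (simp add: R_def)
  qed
  have "R 0 1"
  proof (rule connected_equivalence_relation[where S="{0..1::real}"])
    show "R u t" if "R t u" "t \<in> {0..1}" "u \<in> {0..1}" for t u using R_sym that .
    show "R t w" if "R t u" "R u w" "t \<in> {0..1}" "u \<in> {0..1}" "w \<in> {0..1}" for t u w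
      using R_trans that .
    fix t :: real assume t: "t \<in> {0..1}"
    obtain \<epsilon> where \<epsilon>: "\<epsilon> > 0" "ball (c t) \<epsilon> \<subseteq> U"
      "\<And>w. w \<in> ball (c t) \<epsilon> \<Longrightarrow> homotopic_paths X (linepath (c t) w +++ s w) (s (c t))"
      using s cU[OF t] unfolding path_section_def by meson
    have "continuous_on {0..1} c" using pc by (simp add: path_def)
    then obtain d where d: "d > 0" "\<And>u. u \<in> {0..1} \<Longrightarrow> dist u t < d \<Longrightarrow> dist (c u) (c t) < \<epsilon>"
      using \<epsilon>(1) t unfolding continuous_on_iff by metis
    show "\<exists>T. openin (top_of_set {0..1}) T \<and> t \<in> T \<and> (\<forall>u\<in>T. R t u)"
    proof (intro exI[of _ "{0..1} \<inter> ball t d"] conjI ballI)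
      show "openin (top_of_set {0..1}) ({0..1} \<inter> ball t d)"
        by (simp add: openin_open_Int)
      fix u assume u: "u \<in> {0..1} \<inter> ball t d"
      have "path_image (subpath t u c) \<subseteq> ball (c t) \<epsilon>"
      proof
        fix y assume "y \<in> path_image (subpath t u c)"
        then obtain v where v: "v \<in> closed_segment t u" "y = c v"
          by (auto simp: path_image_subpath_gen)
        have "closed_segment t u \<subseteq> {0..1} \<inter> ball t d"
          using u t d(1) by (intro closed_segment_subset) (auto intro!: convex_Int)
        then have "v \<in> {0..1} \<inter> ball t d" using v by blast
        with v d(2)[of v] show "y \<in> ball (c t) \<epsilon>"
          by (auto simp: dist_commute)
      qed
      moreover have w: "c u \<in> ball (c t) \<epsilon>" using d(2)[of u] u by (auto simp: dist_commute)
      ultimately have "homotopic_paths X (subpath t u c) (linepath (c t) (c u))"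
        using \<epsilon> UX subU[of t u] u t
        by (intro homotopic_paths_in_convex[where C="ball (c t) \<epsilon>" and u="c t" and v="c u"])
           (auto simp: path_in_def closed_segment_subset)
      then have "homotopic_paths X (subpath t u c +++ s (c u)) (linepath (c t) (c u) +++ s (c u))"
        using sp[of u] u sub[of t u] t by (intro homotopic_paths_join) (auto simp: path_in_def)
      also have "homotopic_paths X \<dots> (s (c t))" using \<epsilon>(3)[OF w] .
      finally show "R t u" by (simp add: R_def)
    qed (use t d in auto)
  qed auto
  then show ?thesis using c by (auto simp: R_def path_in_def pathstart_def pathfinish_def)
qed

lemma path_section_agree_along:
  assumes s: "path_section X e U s" and s': "path_section X e U' s'"
    and c: "path_in (U \<inter> U') a b c" and h: "homotopic_paths X (s b) (s' b)"
  shows "homotopic_paths X (s a) (s' a)"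
proof -
  have c1: "path_in U a b c" and c2: "path_in U' a b c"
    using path_in_mono[OF c] by auto
  have UX: "U \<subseteq> X" using s by (simp add: path_section_def)
  have b: "b \<in> U" "b \<in> U'" using c by (auto simp: path_in_def)
  have "homotopic_paths X (s a) (c +++ s b)"
    using path_section_transport[OF s c1] homotopic_paths_sym by blast
  also have "homotopic_paths X \<dots> (c +++ s' b)"
    using h c1 UX path_section_path[OF s b(1)]
    by (intro homotopic_paths_join) (auto simp: path_in_def)
  also have "homotopic_paths X \<dots> (s' a)" using path_section_transport[OF s' c2] .
  finally show ?thesis .
qed

lemma path_section_agree_convex:
  assumes "path_section X e U s" "path_section X e U' s'" "convex C" "C \<subseteq> U" "C \<subseteq> U'"
    "a \<in> C" "b \<in> C" "homotopic_paths X (s b) (s' b)"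
  shows "homotopic_paths X (s a) (s' a)"
proof (rule path_section_agree_along[OF assms(1,2)])
  show "path_in (U \<inter> U') a b (linepath a b)"
    using assms closed_segment_subset[of a C b] by (auto simp: path_in_linepath)
qed fact

text \<open>In a ball contained in both domains, transport along segments carries agreement in
  either direction, so agreement is locally constant.\<close>

lemma path_section_agree_clopen:
  assumes s: "path_section X e U s" and s': "path_section X e U' s'"
  shows "open {z \<in> U \<inter> U'. homotopic_paths X (s z) (s' z)}" (is "open ?A")
    and "open {z \<in> U \<inter> U'. \<not> homotopic_paths X (s z) (s' z)}" (is "open ?B")
proof -
  have o: "open (U \<inter> U')" using s s' by (simp add: path_section_def open_Int)
  have *: "\<exists>d>0. ball z d \<subseteq> U \<inter> U' \<and>
      (\<forall>w\<in>ball z d. homotopic_paths X (s w) (s' w) \<longleftrightarrow> homotopic_paths X (s z) (s' z))"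
    if z: "z \<in> U \<inter> U'" for z
  proof -
    from o z obtain d where d: "d > 0" "ball z d \<subseteq> U \<inter> U'"
      using open_contains_ball by blast
    then have "homotopic_paths X (s w) (s' w) \<longleftrightarrow> homotopic_paths X (s z) (s' z)" if "w \<in> ball z d" for w
      using path_section_agree_convex[OF s s', of "ball z d" z w]
        path_section_agree_convex[OF s s', of "ball z d" w z] that by auto
    with d show ?thesis by blast
  qed
  show "open ?A"
    unfolding open_contains_ball
  proof
    fix z assume z: "z \<in> ?A"
    with *[of z] obtain d where "d > 0" "ball z d \<subseteq> ?A" by blast
    then show "\<exists>d>0. ball z d \<subseteq> ?A" by blast
  qed
  show "open ?B"
    unfolding open_contains_ball
  proof
    fix z assume z: "z \<in> ?B"
    with *[of z] obtain d where "d > 0" "ball z d \<subseteq> ?B" by blast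
    then show "\<exists>d>0. ball z d \<subseteq> ?B" by blast
  qed
qed

lemma path_section_agree_connected:
  assumes s: "path_section X e U s" and s': "path_section X e U' s'"
    and C: "connected C" "C \<subseteq> U" "C \<subseteq> U'" "a \<in> C" "b \<in> C" and h: "homotopic_paths X (s b) (s' b)"
  shows "homotopic_paths X (s a) (s' a)"
proof (rule ccontr)
  assume n: "\<not> homotopic_paths X (s a) (s' a)"
  let ?A = "{z \<in> U \<inter> U'. homotopic_paths X (s z) (s' z)}"
  let ?B = "{z \<in> U \<inter> U'. \<not> homotopic_paths X (s z) (s' z)}"
  have "?A \<inter> C = {} \<or> ?B \<inter> C = {}"
    using path_section_agree_clopen[OF s s'] C by (intro connectedD) auto
  with C h n show False by auto
qed

text \<open>Representatives are picked pointwise by choice, without any continuity between the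
  picks. This is harmless: \<open>agree\<close> determines the homotopy class, and near a given
  point all classes are compared with one fixed member of \<open>F\<close>.\<close>

lemma path_section_Union:
  assumes F: "\<And>U s. (U, s) \<in> F \<Longrightarrow> path_section X e U s"
    and agree: "\<And>U s U' s' z. \<lbrakk>(U, s) \<in> F; (U', s') \<in> F; z \<in> U; z \<in> U'\<rbrakk> \<Longrightarrow> homotopic_paths X (s z) (s' z)"
  obtains t where "path_section X e (\<Union>(fst ` F)) t"
    "\<And>U s z. (U, s) \<in> F \<Longrightarrow> z \<in> U \<Longrightarrow> homotopic_paths X (t z) (s z)"
proof -
  define P where "P z = (SOME P. P \<in> F \<and> z \<in> fst P)" for z
  define t where "t z = snd (P z) z" for z
  have P: "P z \<in> F \<and> z \<in> fst (P z)" if "z \<in> \<Union>(fst ` F)" for z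
  proof -
    have "\<exists>P. P \<in> F \<and> z \<in> fst P" using that by blast
    then show ?thesis unfolding P_def by (rule someI_ex)
  qed
  have t: "homotopic_paths X (t z) (s z)" if "(U, s) \<in> F" "z \<in> U" for U s z
  proof -
    have "z \<in> \<Union>(fst ` F)" using that by force
    from P[OF this] have "(fst (P z), snd (P z)) \<in> F" "z \<in> fst (P z)" by auto
    from agree[OF this(1) that(1) this(2) that(2)] show ?thesis
      by (simp add: t_def)
  qed
  have "path_section X e (\<Union>(fst ` F)) t"
    unfolding path_section_def
  proof (intro conjI ballI)
    show "open (\<Union>(fst ` F))" "\<Union>(fst ` F) \<subseteq> X"
      using F by (force simp: path_section_def)+
    fix z assume z: "z \<in> \<Union>(fst ` F)"
    obtain U s where Us: "(U, s) \<in> F" "z \<in> U" using z by force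
    note sec = F[OF Us(1)]
    show "path_in X z e (t z)"
      using t[OF Us] path_section_path[OF sec Us(2)]
      by (auto simp: path_in_def dest: homotopic_paths_imp_path homotopic_paths_imp_subset
        homotopic_paths_imp_pathstart homotopic_paths_imp_pathfinish)
    obtain \<epsilon> where \<epsilon>: "\<epsilon> > 0" "ball z \<epsilon> \<subseteq> U"
      "\<And>w. w \<in> ball z \<epsilon> \<Longrightarrow> homotopic_paths X (linepath z w +++ s w) (s z)"
      using sec Us unfolding path_section_def by meson
    have "homotopic_paths X (linepath z w +++ t w) (t z)" if w: "w \<in> ball z \<epsilon>" for w
    proof -
      have wU: "w \<in> U" using w \<epsilon> by auto
      have "closed_segment z w \<subseteq> ball z \<epsilon>" using w \<epsilon>(1) by (intro closed_segment_subset) auto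
      then have "path_in X z w (linepath z w)"
        using \<epsilon>(2) sec by (auto simp: path_in_linepath path_section_def)
      then have "homotopic_paths X (linepath z w +++ t w) (linepath z w +++ s w)"
        using t[OF Us(1) wU] path_section_path[OF sec wU]
        by (intro homotopic_paths_join)
           (auto simp: path_in_def dest: homotopic_paths_imp_pathstart)
      also have "homotopic_paths X \<dots> (s z)" using \<epsilon>(3)[OF w] .
      also have "homotopic_paths X \<dots> (t z)" using t[OF Us] homotopic_paths_sym by blast
      finally show ?thesis .
    qed
    moreover have "ball z \<epsilon> \<subseteq> \<Union>(fst ` F)" using \<epsilon>(2) Us by force
    ultimately show "\<exists>\<epsilon>>0. ball z \<epsilon> \<subseteq> \<Union>(fst ` F) \<and> (\<forall>w\<in>ball z \<epsilon>. homotopic_paths X (linepath z w +++ t w) (t z))"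
      using \<epsilon>(1) by blast
  qed
  with t that show ?thesis by blast
qed

text \<open>The covering is trivial over \<open>B\<close>: straight segments to \<open>b\<close> are
  put in front of the prescribed class \<open>p\<close>, and triangles inside \<open>B\<close> can
  be contracted.\<close>

lemma path_section_convex:
  fixes B :: "'a::real_normed_vector set"
  assumes B: "open B" "convex B" "B \<subseteq> X" "b \<in> B" and p: "path_in X b e p"
  obtains s where "path_section X e B s" "homotopic_paths X (s b) p"
proof
  have seg: "closed_segment z w \<subseteq> B" if "z \<in> B" "w \<in> B" for z w
    using that B closed_segment_subset by blast
  show "path_section X e B (\<lambda>z. linepath z b +++ p)"
    unfolding path_section_def
  proof (intro conjI ballI)
    fix z assume z: "z \<in> B"
    have zb: "path_in X y b (linepath y b)" if "y \<in> B" for y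
      using seg[OF that \<open>b \<in> B\<close>] B(3) by (auto simp: path_in_linepath)
    show "path_in X z e (linepath z b +++ p)"
      using path_in_join[OF zb[OF z] p] .
    obtain \<epsilon> where \<epsilon>: "\<epsilon> > 0" "ball z \<epsilon> \<subseteq> B" using B z open_contains_ball by blast
    have "homotopic_paths X (linepath z w +++ linepath w b +++ p) (linepath z b +++ p)"
      if w: "w \<in> ball z \<epsilon>" for w
    proof -
      have wB: "w \<in> B" using w \<epsilon> by auto
      have zw: "path_in X z w (linepath z w)"
        using seg[OF z wB] B(3) by (auto simp: path_in_linepath)
      have "homotopic_paths X (linepath z w +++ linepath w b +++ p) ((linepath z w +++ linepath w b) +++ p)"
        using zw zb[OF wB] p by (intro homotopic_paths_assoc) (auto simp: path_in_def)
      also have "homotopic_paths X \<dots> (linepath z b +++ p)"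
      proof (rule homotopic_paths_join)
        show "homotopic_paths X (linepath z w +++ linepath w b) (linepath z b)"
          using seg z wB B
          by (intro homotopic_paths_in_convex[where C=B and u=z and v=b] path_in_join[of _ _ w])
             (auto simp: path_in_linepath)
      qed (use p in \<open>auto simp: path_in_def\<close>)
      finally show ?thesis .
    qed
    with \<epsilon> show "\<exists>\<epsilon>>0. ball z \<epsilon> \<subseteq> B \<and>
        (\<forall>w\<in>ball z \<epsilon>. homotopic_paths X (linepath z w +++ linepath w b +++ p) (linepath z b +++ p))"
      by blast
  qed (use B in auto)
  show "homotopic_paths X (linepath b b +++ p) p"
    using homotopic_paths_lid[of p X] p by (auto simp: path_in_def)
qed

text \<open>Paths in \<open>S\<close> with common ends are homotopic, so an arbitrary choice of a
  path to \<open>e\<close> from each point is automatically a section.\<close>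

lemma path_section_simply_connected:
  fixes S :: "'a::real_normed_vector set"
  assumes S: "simply_connected S" "S \<subseteq> X" "e \<in> S" and U: "open U" "U \<subseteq> S"
  obtains s where "path_section X e U s"
proof -
  have pc: "path_connected S" and h: "\<And>p q u v. path_in S u v p \<Longrightarrow> path_in S u v q \<Longrightarrow> homotopic_paths S p q"
    using S(1) unfolding simply_connected_eq_homotopic_paths path_in_def by auto
  have "\<forall>z\<in>S. \<exists>p. path_in S z e p"
    using pc S(3) unfolding path_connected_def path_in_def by blast
  then obtain s where s: "\<And>z. z \<in> S \<Longrightarrow> path_in S z e (s z)" by metis
  have "path_section X e U s"
    unfolding path_section_def
  proof (intro conjI ballI)
    fix z assume z: "z \<in> U"
    show "path_in X z e (s z)" using s[of z] z U S by (auto intro: path_in_mono)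
    obtain \<epsilon> where \<epsilon>: "\<epsilon> > 0" "ball z \<epsilon> \<subseteq> U" using U z open_contains_ball by blast
    have "homotopic_paths X (linepath z w +++ s w) (s z)" if w: "w \<in> ball z \<epsilon>" for w
    proof -
      have "closed_segment z w \<subseteq> ball z \<epsilon>" using w \<epsilon>(1) by (intro closed_segment_subset) auto
      then have "path_in S z w (linepath z w)" using \<epsilon> U by (auto simp: path_in_linepath)
      moreover have "w \<in> S" "z \<in> S" using w z \<epsilon> U by (auto simp: subset_iff)
      then have "path_in S w e (s w)" "path_in S z e (s z)" using s by blast+
      ultimately show ?thesis
        using h[of z e] path_in_join homotopic_paths_subset S(2) by metis
    qed
    with \<epsilon> show "\<exists>\<epsilon>>0. ball z \<epsilon> \<subseteq> U \<and> (\<forall>w\<in>ball z \<epsilon>. homotopic_paths X (linepath z w +++ s w) (s z))"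
      by blast
  qed (use S U in auto)
  then show ?thesis using that by blast
qed

text \<open>Transport around a loop \<open>p\<close> at \<open>a\<close> shows that
  \<open>p +++ s a\<close> is homotopic to \<open>s a\<close>; cancelling \<open>s a\<close>
  contracts \<open>p\<close>.\<close>

lemma simply_connected_if_path_section:
  assumes s: "path_section X e X s"
  shows "simply_connected X"
  unfolding simply_connected_eq_contractible_path
proof (intro conjI allI impI)
  note sp = path_section_path[OF s]
  show "path_connected X"
    unfolding path_connected_def
  proof (intro ballI)
    fix x y assume "x \<in> X" "y \<in> X"
    then have "path_in X x y (s x +++ reversepath (s y))"
      using path_in_join path_in_reverse sp by blast
    then show "\<exists>g. path g \<and> path_image g \<subseteq> X \<and> pathstart g = x \<and> pathfinish g = y"
      unfolding path_in_def by blast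
  qed
  fix p assume "path p \<and> path_image p \<subseteq> X \<and> pathfinish p = pathstart p"
  then have p: "path_in X (pathstart p) (pathstart p) p" by (simp add: path_in_def)
  define a where "a = pathstart p"
  have a: "a \<in> X" using p by (auto simp: path_in_def a_def)
  have l: "path_in X a a (linepath a a)" using a by (simp add: path_in_linepath)
  have "homotopic_paths X (p +++ s a) (linepath a a +++ s a)"
    using path_section_transport[OF s] p l homotopic_paths_trans homotopic_paths_sym
    unfolding a_def by blast
  then show "homotopic_paths X p (linepath (pathstart p) (pathstart p))"
    using homotopic_paths_right_cancel[OF _ l sp[OF a]] p by (simp add: a_def)
qed

section \<open>Extending a section along superlevel sets\<close>

text \<open>A derivative-free substitute for Morse theory. \<open>max_principle\<close> yields
  uniqueness of extensions, \<open>locally_connected_superlevel\<close> makes an extension past a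
  boundary point consistent. \<open>outward_ascent\<close> provides nearby points above the level
  where sections can be compared; the growth of the norm places them beyond \<open>R\<close> when
  \<open>norm x = R\<close>.\<close>

locale superlevel_extension =
  fixes X :: "'a::euclidean_space set" and e :: 'a and \<psi> :: "'a \<Rightarrow> real" and R R' :: real
    and s\<^sub>E :: "'a \<Rightarrow> real \<Rightarrow> 'a"
  assumes cont: "continuous_on UNIV \<psi>"
    and superlevel_subset: "{z. \<psi> z > 0} \<subseteq> X"
    and radii: "R' < R"
    and exterior_section: "path_section X e {z. norm z > R'} s\<^sub>E"
    and max_principle: "\<And>r C. \<lbrakk>r \<ge> 0; open C; C \<noteq> {}; C \<subseteq> {z. \<psi> z > r}; C \<subseteq> cball 0 R;
      closure C \<inter> {z. \<psi> z > r} \<subseteq> C\<rbrakk> \<Longrightarrow> False"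
    and locally_connected_superlevel: "\<And>x \<rho>. \<lbrakk>\<psi> x > 0; \<rho> > 0\<rbrakk> \<Longrightarrow>
      \<exists>N \<sigma>. \<sigma> > 0 \<and> ball x \<sigma> \<subseteq> N \<and> N \<subseteq> ball x \<rho> \<and> connected {y \<in> N. \<psi> y > \<psi> x}"
    and outward_ascent: "\<And>x \<rho>. \<lbrakk>\<psi> x > 0; \<rho> > 0\<rbrakk> \<Longrightarrow> \<exists>y\<in>ball x \<rho>. \<psi> y > \<psi> x \<and> norm y > norm x"
begin

text \<open>Agreement is prescribed only beyond \<open>R\<close> although \<open>s\<^sub>E\<close>
  is defined beyond \<open>R'\<close>. The collar in between gives every point of norm
  \<open>R\<close> a full neighbourhood in the domain of \<open>s\<^sub>E\<close>.\<close>

definition extends_to :: "real \<Rightarrow> ('a \<Rightarrow> real \<Rightarrow> 'a) \<Rightarrow> bool" where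
  "extends_to r s \<longleftrightarrow> path_section X e {z. \<psi> z > r} s \<and>
     (\<forall>z. \<psi> z > r \<longrightarrow> norm z > R \<longrightarrow> homotopic_paths X (s z) (s\<^sub>E z))"

lemma open_superlevel: "open {z. \<psi> z > r}"
  using cont by (intro open_Collect_less) auto

text \<open>The set of disagreement is open and relatively closed in the superlevel set, and it lies
  in \<open>cball 0 R\<close> because beyond \<open>R\<close> both sections agree with
  \<open>s\<^sub>E\<close>. By \<open>max_principle\<close> it is empty.\<close>

lemma extends_to_unique:
  assumes s: "extends_to r s" and s': "extends_to r' s'" and r: "0 \<le> r" "r' \<le> r" and z: "\<psi> z > r"
  shows "homotopic_paths X (s z) (s' z)"
proof (rule ccontr)
  assume n: "\<not> homotopic_paths X (s z) (s' z)"
  have sec: "path_section X e {z. \<psi> z > r} s"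
    using s unfolding extends_to_def by blast
  have sec': "path_section X e {z. \<psi> z > r} s'"
    using s' r open_superlevel unfolding extends_to_def
    by (auto intro: path_section_subset[of X e "{z. \<psi> z > r'}"])
  define A where "A = {z. \<psi> z > r \<and> homotopic_paths X (s z) (s' z)}"
  define C where "C = {z. \<psi> z > r \<and> \<not> homotopic_paths X (s z) (s' z)}"
  have oA: "open A" and oC: "open C"
    using path_section_agree_clopen[OF sec sec'] by (auto simp: A_def C_def)
  have "A \<inter> closure C = {}"
    using oA by (subst open_Int_closure_eq_empty) (auto simp: A_def C_def)
  then have "closure C \<inter> {z. \<psi> z > r} \<subseteq> C"
    by (auto simp: A_def C_def)
  moreover have "C \<subseteq> cball 0 R"
  proof
    fix y assume y: "y \<in> C"
    show "y \<in> cball 0 R"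
    proof (rule ccontr)
      assume "y \<notin> cball 0 R"
      then have "homotopic_paths X (s y) (s\<^sub>E y)" "homotopic_paths X (s' y) (s\<^sub>E y)"
        using s s' y r by (auto simp: extends_to_def C_def)
      then show False
        using y homotopic_paths_trans homotopic_paths_sym unfolding C_def by blast
    qed
  qed
  ultimately show False
    using max_principle[of r C] oC z n r by (auto simp: C_def)
qed

text \<open>The superlevel set of \<open>i\<close> is the union of those of attainable levels close
  to \<open>i\<close>; by uniqueness their sections agree on overlaps and glue.\<close>

lemma extends_to_limit:
  assumes G: "\<And>r. r > i \<Longrightarrow> \<exists>q<r. q > 0 \<and> (\<exists>s. extends_to q s)" and i: "i \<ge> 0"
    and lower: "\<And>r s. r > 0 \<Longrightarrow> extends_to r s \<Longrightarrow> i \<le> r"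
  obtains s where "extends_to i s"
proof -
  define F where "F = {({z. \<psi> z > r}, s) | r s. r > 0 \<and> extends_to r s}"
  have 1: "path_section X e U s" if "(U, s) \<in> F" for U s
    using that by (auto simp: F_def extends_to_def)
  have 2: "homotopic_paths X (s z) (s' z)"
    if h: "(U, s) \<in> F" "(U', s') \<in> F" "z \<in> U" "z \<in> U'" for U s U' s' z
  proof -
    obtain r where r: "U = {z. \<psi> z > r}" "r > 0" "extends_to r s" using h by (auto simp: F_def)
    obtain r' where r': "U' = {z. \<psi> z > r'}" "r' > 0" "extends_to r' s'" using h by (auto simp: F_def)
    show ?thesis
    proof (cases "r' \<le> r")
      case True
      then show ?thesis using extends_to_unique[OF r(3) r'(3), of z] r r' h by auto
    next
      case False
      then show ?thesis
        using extends_to_unique[OF r'(3) r(3), of z] r r' h homotopic_paths_sym by auto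
    qed
  qed
  obtain t where t: "path_section X e (\<Union>(fst ` F)) t"
    "\<And>U s z. (U, s) \<in> F \<Longrightarrow> z \<in> U \<Longrightarrow> homotopic_paths X (t z) (s z)"
    using path_section_Union[of F X e] 1 2 by metis
  have ex: "\<exists>U s. (U, s) \<in> F \<and> z \<in> U \<and> (\<exists>r. U = {z. \<psi> z > r} \<and> extends_to r s)"
    if "\<psi> z > i" for z
    using G[OF that] unfolding F_def by blast
  have "\<Union>(fst ` F) = {z. \<psi> z > i}"
  proof
    show "\<Union>(fst ` F) \<subseteq> {z. \<psi> z > i}" using lower by (fastforce simp: F_def)
    show "{z. \<psi> z > i} \<subseteq> \<Union>(fst ` F)"
    proof
      fix z assume "z \<in> {z. \<psi> z > i}"
      with ex[of z] show "z \<in> \<Union>(fst ` F)" by force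
    qed
  qed
  moreover have "homotopic_paths X (t z) (s\<^sub>E z)" if z: "\<psi> z > i" "norm z > R" for z
  proof -
    obtain U s r where U: "(U, s) \<in> F" "z \<in> U" "U = {z. \<psi> z > r}" "extends_to r s"
      using ex[OF z(1)] by blast
    have "homotopic_paths X (t z) (s z)" using t(2) U by blast
    also have "homotopic_paths X \<dots> (s\<^sub>E z)" using U z by (auto simp: extends_to_def)
    finally show ?thesis .
  qed
  ultimately have "extends_to i t" using t(1) by (simp add: extends_to_def)
  then show ?thesis using that by blast
qed

text \<open>A ball around \<open>x\<close> carries a section \<open>t\<close> with prescribed class
  at one point \<open>y\<close> above the level. The part of \<open>N\<close> above the level is
  connected, so agreement with \<open>s\<close> spreads from \<open>y\<close> over all of it. The
  radius is written \<open>3 * \<eta>\<close> because concentric balls of radius \<eta> will later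
  be compared inside the tripled ones.\<close>

lemma local_extension:
  assumes s: "extends_to r s" and r: "r > 0" and x: "\<psi> x = r" "norm x \<le> R"
  obtains \<eta> t where "\<eta> > 0" "path_section X e (ball x (3 * \<eta>)) t"
    "\<And>y. y \<in> ball x (3 * \<eta>) \<Longrightarrow> \<psi> y > r \<Longrightarrow> homotopic_paths X (t y) (s y)"
    "\<And>y. y \<in> ball x (3 * \<eta>) \<Longrightarrow> norm y > R \<Longrightarrow> homotopic_paths X (t y) (s\<^sub>E y)"
proof -
  have sec: "path_section X e {z. \<psi> z > r} s" using s by (simp add: extends_to_def)
  \<comment> \<open>For \<open>norm x < R\<close> the ball is kept inside radius \<open>R\<close>,
    so the claim about \<open>s\<^sub>E\<close> is vacuous. For \<open>norm x = R\<close> it is kept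
    in the domain of \<open>s\<^sub>E\<close>, and the comparison starts at \<open>y\<close>, whose
    norm exceeds \<open>R\<close>.\<close>
  define G :: "'a set" where "G = (if norm x < R then ball 0 R else {z. norm z > R'})"
  have "open G" "x \<in> G"
    using radii x by (auto simp: G_def intro!: open_Collect_less continuous_intros)
  then have "open ({z. \<psi> z > 0} \<inter> G)" "x \<in> {z. \<psi> z > 0} \<inter> G"
    using open_superlevel x r by auto
  then obtain \<rho> where \<rho>: "\<rho> > 0" "ball x \<rho> \<subseteq> {z. \<psi> z > 0} \<inter> G"
    using open_contains_ball by blast
  obtain N \<sigma> where N: "\<sigma> > 0" "ball x \<sigma> \<subseteq> N" "N \<subseteq> ball x \<rho>" "connected {y \<in> N. \<psi> y > \<psi> x}"
    using locally_connected_superlevel[of x \<rho>] x r \<rho> by auto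
  obtain y where y: "y \<in> ball x \<sigma>" "\<psi> y > \<psi> x" "norm y > norm x"
    using outward_ascent[of x \<sigma>] x r N by auto
  have ys: "path_in X y e (s y)" using path_section_path[OF sec] y x by auto
  have yN: "y \<in> N" "y \<in> ball x \<rho>" using y N by blast+
  have "ball x \<rho> \<subseteq> X" using \<rho> superlevel_subset by blast
  then obtain t where t: "path_section X e (ball x \<rho>) t" "homotopic_paths X (t y) (s y)"
    using path_section_convex[of "ball x \<rho>" X y e "s y"] yN ys by auto
  have sub: "ball x (3 * (\<sigma>/3)) \<subseteq> ball x \<rho>" using subset_trans[OF N(2,3)] by simp
  show ?thesis
  proof (rule that[of "\<sigma>/3" t])
    show "\<sigma> / 3 > 0" using N by simp
    show "path_section X e (ball x (3 * (\<sigma>/3))) t"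
      using path_section_subset[OF t(1) _ sub] by blast
    fix w assume w: "w \<in> ball x (3 * (\<sigma>/3))"
    then have wN: "w \<in> N" using N(2) by auto
    show "homotopic_paths X (t w) (s w)" if "\<psi> w > r"
      using that wN yN y x N
      by (intro path_section_agree_connected[OF t(1) sec N(4) _ _ _ _ t(2)]) auto
    show "homotopic_paths X (t w) (s\<^sub>E w)" if wR: "norm w > R"
    proof -
      have "w \<in> G" using w sub \<rho> by blast
      with wR have nx: "\<not> norm x < R" by (auto simp: G_def split: if_splits)
      then have "ball x \<rho> \<subseteq> {z. norm z > R'}" using \<rho> by (auto simp: G_def)
      moreover have "homotopic_paths X (t y) (s\<^sub>E y)"
      proof -
        have "homotopic_paths X (s y) (s\<^sub>E y)"
          using s y nx x by (auto simp: extends_to_def)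
        with t(2) show ?thesis using homotopic_paths_trans by blast
      qed
      ultimately show ?thesis
        using path_section_agree_convex[OF t(1) exterior_section, of "ball x \<rho>" w y] w sub yN
        by auto
    qed
  qed
qed

text \<open>Compactness makes the drop of the level uniform: the part of \<open>cball 0 R\<close>
  missed by the glued domain is compact and lies strictly below level \<open>r\<close>, so some
  \<open>q < r\<close> bounds \<psi> there.\<close>

lemma extends_to_lower:
  assumes s: "extends_to r s" and r: "r > 0"
  obtains q t where "0 < q" "q < r" "extends_to q t"
proof -
  have sec: "path_section X e {z. \<psi> z > r} s" using s by (simp add: extends_to_def)
  define L where "L = {x. \<psi> x = r \<and> norm x \<le> R}"
  have "\<forall>x\<in>L. \<exists>\<eta> t. \<eta> > 0 \<and> path_section X e (ball x (3 * \<eta>)) t \<and>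
    (\<forall>y\<in>ball x (3 * \<eta>). \<psi> y > r \<longrightarrow> homotopic_paths X (t y) (s y)) \<and>
    (\<forall>y\<in>ball x (3 * \<eta>). norm y > R \<longrightarrow> homotopic_paths X (t y) (s\<^sub>E y))"
  proof
    fix x assume "x \<in> L"
    then have x: "\<psi> x = r" "norm x \<le> R" by (auto simp: L_def)
    obtain \<eta> t where "\<eta> > 0" "path_section X e (ball x (3 * \<eta>)) t"
      "\<And>y. y \<in> ball x (3 * \<eta>) \<Longrightarrow> \<psi> y > r \<Longrightarrow> homotopic_paths X (t y) (s y)"
      "\<And>y. y \<in> ball x (3 * \<eta>) \<Longrightarrow> norm y > R \<Longrightarrow> homotopic_paths X (t y) (s\<^sub>E y)"
      using local_extension[OF s r x] by metis
    then show "\<exists>\<eta> t. \<eta> > 0 \<and> path_section X e (ball x (3 * \<eta>)) t \<and>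
        (\<forall>y\<in>ball x (3 * \<eta>). \<psi> y > r \<longrightarrow> homotopic_paths X (t y) (s y)) \<and>
        (\<forall>y\<in>ball x (3 * \<eta>). norm y > R \<longrightarrow> homotopic_paths X (t y) (s\<^sub>E y))" by blast
  qed
  from this[THEN bchoice] obtain \<eta> where "\<forall>x\<in>L. \<exists>t. \<eta> x > 0 \<and> path_section X e (ball x (3 * \<eta> x)) t \<and>
    (\<forall>y\<in>ball x (3 * \<eta> x). \<psi> y > r \<longrightarrow> homotopic_paths X (t y) (s y)) \<and>
    (\<forall>y\<in>ball x (3 * \<eta> x). norm y > R \<longrightarrow> homotopic_paths X (t y) (s\<^sub>E y))" ..
  from this[THEN bchoice] obtain t where t: "\<forall>x\<in>L. \<eta> x > 0 \<and> path_section X e (ball x (3 * \<eta> x)) (t x) \<and>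
    (\<forall>y\<in>ball x (3 * \<eta> x). \<psi> y > r \<longrightarrow> homotopic_paths X (t x y) (s y)) \<and>
    (\<forall>y\<in>ball x (3 * \<eta> x). norm y > R \<longrightarrow> homotopic_paths X (t x y) (s\<^sub>E y))" ..
  have \<eta>: "\<eta> x > 0" "path_section X e (ball x (3 * \<eta> x)) (t x)" if "x \<in> L" for x
    using t that by auto
  have t_s: "homotopic_paths X (t x y) (s y)" if "x \<in> L" "y \<in> ball x (3 * \<eta> x)" "\<psi> y > r" for x y
    using t that by auto
  have t_E: "homotopic_paths X (t x y) (s\<^sub>E y)" if "x \<in> L" "y \<in> ball x (\<eta> x)" "norm y > R" for x y
    using t that \<eta>(1)[OF that(1)] by auto
  \<comment> \<open>If the balls of radii \<open>\<eta> x' \<le> \<eta> x\<close> meet, their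
    centres are less than \<open>2 * \<eta> x\<close> apart, so \<open>x'\<close> lies in the
    tripled ball about \<open>x\<close>. Arbitrarily near \<open>x'\<close> there are points above
    level \<open>r\<close>, where both sections agree with \<open>s\<close>. The intersection of the
    tripled balls is convex and carries this agreement to \<open>z\<close>.\<close>
  have t_t': "homotopic_paths X (t x z) (t x' z)"
    if x: "x \<in> L" "x' \<in> L" "z \<in> ball x (\<eta> x)" "z \<in> ball x' (\<eta> x')" and le: "\<eta> x' \<le> \<eta> x" for x x' z
  proof -
    have "dist x x' \<le> dist x z + dist x' z" by (simp add: dist_triangle2)
    then have "dist x x' < 3 * \<eta> x" using x le \<eta>(1)[OF x(1)] by simp
    then have "min (\<eta> x') (3 * \<eta> x - dist x x') > 0" using \<eta>(1)[OF x(2)] by auto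
    moreover have "\<psi> x' > 0" using x r by (simp add: L_def)
    ultimately obtain y where y: "y \<in> ball x' (min (\<eta> x') (3 * \<eta> x - dist x x'))" "\<psi> y > \<psi> x'"
      using outward_ascent[of x' "min (\<eta> x') (3 * \<eta> x - dist x x')"] by blast
    have yr: "\<psi> y > r" using y x by (auto simp: L_def)
    have y': "y \<in> ball x' (3 * \<eta> x')" using y \<eta>(1)[OF x(2)] by auto
    have "dist x y \<le> dist x x' + dist x' y" by (rule dist_triangle)
    then have y3: "y \<in> ball x (3 * \<eta> x)" using y by auto
    have "homotopic_paths X (t x y) (t x' y)"
      using t_s[OF x(1) y3 yr] t_s[OF x(2) y' yr] homotopic_paths_trans homotopic_paths_sym by blast
    moreover have "z \<in> ball x (3 * \<eta> x) \<inter> ball x' (3 * \<eta> x')"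
      using x \<eta>(1)[OF x(1)] \<eta>(1)[OF x(2)] by auto
    ultimately show ?thesis
      using y' y3 \<eta>(2)[OF x(1)] \<eta>(2)[OF x(2)]
      by (intro path_section_agree_convex[of X e "ball x (3 * \<eta> x)" "t x" "ball x' (3 * \<eta> x')" "t x'"
            "ball x (3 * \<eta> x) \<inter> ball x' (3 * \<eta> x')" z y]) (auto simp: convex_Int)
  qed
  define F where "F = insert ({z. \<psi> z > r}, s) (insert ({z. norm z > R}, s\<^sub>E) ((\<lambda>x. (ball x (\<eta> x), t x)) ` L))"
  have 1: "path_section X e U s'" if "(U, s') \<in> F" for U s'
  proof -
    have "path_section X e {z. norm z > R} s\<^sub>E"
      using radii by (intro path_section_subset[OF exterior_section])
        (auto intro!: open_Collect_less continuous_intros)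
    moreover have "path_section X e (ball x (\<eta> x)) (t x)" if "x \<in> L" for x
      using \<eta>[OF that] by (intro path_section_subset[OF \<eta>(2)[OF that]]) auto
    ultimately show ?thesis using that sec by (auto simp: F_def)
  qed
  have 2: "homotopic_paths X (s1 z) (s2 z)"
    if h: "(U1, s1) \<in> F" "(U2, s2) \<in> F" "z \<in> U1" "z \<in> U2" for U1 s1 U2 s2 z
  proof -
    have sE: "homotopic_paths X (s z) (s\<^sub>E z)" if "\<psi> z > r" "norm z > R"
      using s that by (auto simp: extends_to_def)
    have ts: "homotopic_paths X (t x z) (s z)" if "x \<in> L" "z \<in> ball x (\<eta> x)" "\<psi> z > r" for x
      using t_s[of x z] that \<eta>(1)[OF that(1)] by auto
    have tt: "homotopic_paths X (t x z) (t x' z)"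
      if "x \<in> L" "x' \<in> L" "z \<in> ball x (\<eta> x)" "z \<in> ball x' (\<eta> x')" for x x'
      using t_t'[of x x' z] t_t'[of x' x z] that homotopic_paths_sym by (cases "\<eta> x' \<le> \<eta> x") auto
    have cases: "\<psi> z > r \<and> s' z = s z \<or> norm z > R \<and> s' z = s\<^sub>E z \<or>
        (\<exists>x\<in>L. z \<in> ball x (\<eta> x) \<and> s' z = t x z)" if "(U, s') \<in> F" "z \<in> U" for U s'
      using that by (auto simp: F_def)
    have refl: "homotopic_paths X (s1 z) (s1 z)" using path_section_refl[OF 1[OF h(1)] h(3)] .
    have sE': "homotopic_paths X (s\<^sub>E z) (s z)" if "\<psi> z > r" "norm z > R"
      using sE[OF that] homotopic_paths_sym by blast
    have st: "homotopic_paths X (s z) (t x z)" if "x \<in> L" "z \<in> ball x (\<eta> x)" "\<psi> z > r" for x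
      using ts[OF that] homotopic_paths_sym by blast
    have E_t: "homotopic_paths X (s\<^sub>E z) (t x z)" if "x \<in> L" "z \<in> ball x (\<eta> x)" "norm z > R" for x
      using t_E[OF that] homotopic_paths_sym by blast
    show ?thesis
      using cases[OF h(1,3)] cases[OF h(2,4)]
    proof (elim disjE bexE conjE)
      fix x x' assume "x \<in> L" "x' \<in> L" "z \<in> ball x (\<eta> x)" "z \<in> ball x' (\<eta> x')" "s1 z = t x z" "s2 z = t x' z"
      then show ?thesis using tt[of x x'] by simp
    qed (use refl sE sE' ts st t_E E_t in simp_all)
  qed
  obtain u where u: "path_section X e (\<Union>(fst ` F)) u"
    "\<And>U s z. (U, s) \<in> F \<Longrightarrow> z \<in> U \<Longrightarrow> homotopic_paths X (u z) (s z)"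
    using path_section_Union[of F X e] 1 2 by metis
  \<comment> \<open>Points of the ball at level \<open>r\<close> are centres of members of
    \<open>F\<close>, and points above it lie in the domain of \<open>s\<close>; hence \<psi> is
    smaller than \<open>r\<close> on \<open>M\<close>.\<close>
  define M where "M = cball 0 R - \<Union>(fst ` F)"
  have "compact M" unfolding M_def
    using u(1) by (intro compact_diff) (auto simp: path_section_def)
  obtain q where q: "0 < q" "q < r" "\<And>z. z \<in> M \<Longrightarrow> \<psi> z \<le> q"
  proof (cases "M = {}")
    case True
    then show ?thesis using that[of "r/2"] r by auto
  next
    case False
    then obtain m where m: "m \<in> M" "\<And>z. z \<in> M \<Longrightarrow> \<psi> z \<le> \<psi> m"
      using continuous_attains_sup[OF \<open>compact M\<close> False, of \<psi>] cont continuous_on_subset by blast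
    have "\<not> \<psi> m > r" "\<psi> m \<noteq> r"
      using m(1) \<eta>(1)[of m] by (auto simp: M_def F_def L_def)
    then show ?thesis using that[of "max (\<psi> m) (r/2)"] m r by fastforce
  qed
  have sub: "{z. \<psi> z > q} \<subseteq> \<Union>(fst ` F)"
  proof
    fix z assume z: "z \<in> {z. \<psi> z > q}"
    show "z \<in> \<Union>(fst ` F)"
    proof (cases "norm z > R")
      case True
      then show ?thesis by (auto simp: F_def)
    next
      case False
      then show ?thesis using q(3)[of z] z by (auto simp: M_def)
    qed
  qed
  have "extends_to q u"
    unfolding extends_to_def
  proof (intro conjI allI impI)
    show "path_section X e {z. q < \<psi> z} u"
      using path_section_subset[OF u(1) open_superlevel sub] .
    fix z :: 'a assume "norm z > R"
    then show "homotopic_paths X (u z) (s\<^sub>E z)" using u(2)[of "{z. norm z > R}" s\<^sub>E z] by (simp add: F_def)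
  qed
  then show ?thesis using that q by blast
qed

text \<open>Above the maximum of \<psi> on \<open>cball 0 R\<close> the superlevel set lies beyond
  \<open>R\<close>, and \<open>s\<^sub>E\<close> itself serves. The infimum of the attainable
  positive levels is again attainable, and if it were positive it could be lowered.\<close>

lemma section_extends:
  obtains s where "extends_to 0 s"
proof -
  define G where "G = {r. r > 0 \<and> (\<exists>s. extends_to r s)}"
  have "\<exists>M. \<forall>z\<in>cball 0 R. \<psi> z \<le> M"
  proof -
    have "bdd_above (\<psi> ` cball 0 R)"
      using cont by (intro bounded_imp_bdd_above compact_imp_bounded compact_continuous_image)
        (auto intro: continuous_on_subset)
    then show ?thesis by (auto simp: bdd_above_def)
  qed
  then obtain M where M: "\<And>z. z \<in> cball 0 R \<Longrightarrow> \<psi> z \<le> M" by blast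
  define M' where "M' = max M 1"
  have M': "norm z > R" if "\<psi> z > M'" for z
    using M[of z] that by (force simp: M'_def)
  have "path_section X e {z. \<psi> z > M'} s\<^sub>E"
    using M' radii by (intro path_section_subset[OF exterior_section open_superlevel]) force
  then have "extends_to M' s\<^sub>E"
    using path_section_refl by (fastforce simp: extends_to_def)
  then have MG: "M' \<in> G" by (auto simp: G_def M'_def)
  have bdd: "bdd_below G" by (auto simp: G_def bdd_below_def intro!: exI[of _ 0])
  define i where "i = Inf G"
  have i0: "i \<ge> 0" unfolding i_def using MG by (intro cInf_greatest) (auto simp: G_def)
  have lower: "i \<le> r" if "r \<in> G" for r
    unfolding i_def using bdd that by (intro cInf_lower)
  have "\<exists>q\<in>G. q < r" if "r > i" for r
    using that MG bdd unfolding i_def by (subst (asm) cInf_less_iff) auto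
  then obtain s where s: "extends_to i s"
    using extends_to_limit[of i] i0 lower unfolding G_def by blast
  have "i = 0"
  proof (rule ccontr)
    assume "i \<noteq> 0"
    with i0 have "i > 0" by simp
    then obtain q t where "0 < q" "q < i" "extends_to q t" using extends_to_lower[OF s] by blast
    then show False using lower[of q] by (auto simp: G_def)
  qed
  with s that show ?thesis by blast
qed

end

section \<open>Superlevel sets of twice differentiable functions\<close>

text \<open>\<open>f'' z w v\<close> is the derivative in direction \<open>w\<close> of the map
  \<open>\<lambda>z. f' z v\<close>. Continuity is asked for fixed directions, which avoids
  operator-valued derivatives. Symmetry in \<open>w\<close> and \<open>v\<close> is not built in;
  this is why mixed second derivatives occur later as symmetrised sums.\<close>

definition C2 :: "('a::real_normed_vector \<Rightarrow> 'b::real_normed_vector) \<Rightarrow> ('a \<Rightarrow> 'a \<Rightarrow> 'b) \<Rightarrow> ('a \<Rightarrow> 'a \<Rightarrow> 'a \<Rightarrow> 'b) \<Rightarrow> bool" where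
  "C2 f f' f'' \<longleftrightarrow> (\<forall>z. (f has_derivative f' z) (at z)) \<and>
     (\<forall>z v. ((\<lambda>z. f' z v) has_derivative (\<lambda>w. f'' z w v)) (at z)) \<and>
     (\<forall>v w. continuous_on UNIV (\<lambda>z. f'' z w v))"

lemma C2_D1: "C2 f f' f'' \<Longrightarrow> (f has_derivative f' z) (at z)"
  and C2_D2: "C2 f f' f'' \<Longrightarrow> ((\<lambda>z. f' z v) has_derivative (\<lambda>w. f'' z w v)) (at z)"
  and C2_D3: "C2 f f' f'' \<Longrightarrow> continuous_on UNIV (\<lambda>z. f'' z w v)"
  by (auto simp: C2_def)

lemma C2_continuous: "C2 f f' f'' \<Longrightarrow> continuous_on UNIV f"
  by (meson C2_D1 continuous_at_imp_continuous_on has_derivative_continuous)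

lemma C2_continuous1: "C2 f f' f'' \<Longrightarrow> continuous_on UNIV (\<lambda>z. f' z v)"
  by (rule continuous_at_imp_continuous_on) (blast intro: has_derivative_continuous C2_D2)

lemma C2_linear1: "C2 f f' f'' \<Longrightarrow> linear (f' z)"
  by (meson C2_D1 has_derivative_linear)

lemma C2_linear2_left: "C2 f f' f'' \<Longrightarrow> linear (\<lambda>w. f'' z w v)"
  by (rule has_derivative_linear[OF C2_D2])

lemma C2_linear2_right:
  assumes "C2 f f' f''"
  shows "linear (\<lambda>v. f'' z w v)"
proof (rule linearI)
  note d = C2_D2[OF assms, of _ z] and l = C2_linear1[OF assms]
  fix u v :: 'a and c :: real
  have "((\<lambda>z. f' z (u + v)) has_derivative (\<lambda>w. f'' z w u + f'' z w v)) (at z)"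
    using has_derivative_add[OF d[of u] d[of v]] by (simp add: linear_add[OF l])
  from fun_cong[OF has_derivative_unique[OF this d[of "u + v"]], of w]
  show "f'' z w (u + v) = f'' z w u + f'' z w v" by simp
  have "((\<lambda>z. f' z (c *\<^sub>R v)) has_derivative (\<lambda>w. c *\<^sub>R f'' z w v)) (at z)"
    using has_derivative_scaleR_right[OF d[of v], of c] by (simp add: linear_cmul[OF l])
  from fun_cong[OF has_derivative_unique[OF this d[of "c *\<^sub>R v"]], of w]
  show "f'' z w (c *\<^sub>R v) = c *\<^sub>R f'' z w v" by simp
qed

lemma C2_const: "C2 (\<lambda>_. c) (\<lambda>_ _. 0) (\<lambda>_ _ _. 0)"
  by (simp add: C2_def)

lemma C2_bounded_linear: "bounded_linear f \<Longrightarrow> C2 f (\<lambda>_. f) (\<lambda>_ _ _. 0)"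
  by (simp add: C2_def bounded_linear_imp_has_derivative)

lemma C2_add:
  assumes "C2 f f' f''" "C2 g g' g''"
  shows "C2 (\<lambda>z. f z + g z) (\<lambda>z v. f' z v + g' z v) (\<lambda>z w v. f'' z w v + g'' z w v)"
  using assms unfolding C2_def by (auto intro!: has_derivative_add continuous_on_add)

lemma C2_diff:
  assumes "C2 f f' f''" "C2 g g' g''"
  shows "C2 (\<lambda>z. f z - g z) (\<lambda>z v. f' z v - g' z v) (\<lambda>z w v. f'' z w v - g'' z w v)"
  using assms unfolding C2_def by (auto intro!: has_derivative_diff continuous_on_diff)

lemma C2_bilinear:
  assumes p: "bounded_bilinear h" and f: "C2 f f' f''" and g: "C2 g g' g''"
  shows "C2 (\<lambda>z. h (f z) (g z)) (\<lambda>z v. h (f z) (g' z v) + h (f' z v) (g z))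
    (\<lambda>z w v. h (f z) (g'' z w v) + h (f' z w) (g' z v) + (h (f' z v) (g' z w) + h (f'' z w v) (g z)))"
  unfolding C2_def
  by (intro conjI allI has_derivative_add bounded_bilinear.FDERIV[OF p]
      C2_D1[OF f] C2_D2[OF f] C2_D1[OF g] C2_D2[OF g]
      continuous_on_add bounded_bilinear.continuous_on[OF p]
      C2_D3[OF f] C2_D3[OF g] C2_continuous[OF f] C2_continuous[OF g]
      C2_continuous1[OF f] C2_continuous1[OF g])

lemmas C2_mult = C2_bilinear[OF bounded_bilinear_mult]
lemmas C2_inner = C2_bilinear[OF bounded_bilinear_inner]

section \<open>Second derivatives along real lines\<close>

lemma C2_line:
  fixes f :: "'a::real_normed_vector \<Rightarrow> real"
  assumes f: "C2 f f' f''"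
  shows "((\<lambda>t. f (z + t *\<^sub>R w)) has_real_derivative f' (z + t *\<^sub>R w) w) (at t)"
    and "((\<lambda>t. f' (z + t *\<^sub>R w) w) has_real_derivative f'' (z + t *\<^sub>R w) w w) (at t)"
proof -
  have l: "((\<lambda>t. z + t *\<^sub>R w) has_derivative (\<lambda>t. t *\<^sub>R w)) (at t)"
    by (auto intro!: derivative_eq_intros)
  have "((\<lambda>t. f (z + t *\<^sub>R w)) has_derivative (\<lambda>s. f' (z + t *\<^sub>R w) (s *\<^sub>R w))) (at t)"
    using has_derivative_compose[OF l C2_D1[OF f]] .
  then show "((\<lambda>t. f (z + t *\<^sub>R w)) has_real_derivative f' (z + t *\<^sub>R w) w) (at t)"
    by (simp add: has_field_derivative_def linear_cmul[OF C2_linear1[OF f]] mult_commute_abs)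
  have "((\<lambda>t. f' (z + t *\<^sub>R w) w) has_derivative (\<lambda>s. f'' (z + t *\<^sub>R w) (s *\<^sub>R w) w)) (at t)"
    using has_derivative_compose[OF l C2_D2[OF f]] .
  then show "((\<lambda>t. f' (z + t *\<^sub>R w) w) has_real_derivative f'' (z + t *\<^sub>R w) w w) (at t)"
    by (simp add: has_field_derivative_def linear_cmul[OF C2_linear2_left[OF f]] mult_commute_abs)
qed

lemma C2_increase:
  fixes f :: "'a::real_normed_vector \<Rightarrow> real"
  assumes f: "C2 f f' f''" and d: "f' z w \<ge> 0" and t: "t > 0"
    and pos: "\<And>s. 0 \<le> s \<Longrightarrow> s \<le> t \<Longrightarrow> f'' (z + s *\<^sub>R w) w w > 0"
  shows "f (z + t *\<^sub>R w) > f z"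
proof -
  note line = C2_line[OF f, of z w]
  have 1: "f' (z + s *\<^sub>R w) w > 0" if s: "0 < s" "s < t" for s
  proof -
    have "f' (z + 0 *\<^sub>R w) w < f' (z + s *\<^sub>R w) w"
      using s line(2) pos
      by (intro DERIV_pos_imp_increasing[where f="\<lambda>s. f' (z + s *\<^sub>R w) w"]) (auto intro!: exI)
    with d show ?thesis by simp
  qed
  have "f (z + 0 *\<^sub>R w) < f (z + t *\<^sub>R w)"
  proof (rule DERIV_pos_imp_increasing_open[where f="\<lambda>s. f (z + s *\<^sub>R w)", OF t])
    show "continuous_on {0..t} (\<lambda>s. f (z + s *\<^sub>R w))"
      using line(1) by (meson DERIV_continuous continuous_at_imp_continuous_on)
  qed (use 1 line(1) in blast)
  then show ?thesis by simp
qed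

lemma C2_ascent:
  fixes f :: "'a::real_normed_vector \<Rightarrow> real"
  assumes f: "C2 f f' f''" and d: "f' x w \<ge> 0" and pos: "f'' x w w > 0" and \<rho>: "\<rho> > 0"
  obtains t where "t > 0" "t < \<rho>" "f (x + t *\<^sub>R w) > f x"
proof -
  have "continuous (at (0::real)) (\<lambda>t. f'' (x + t *\<^sub>R w) w w)"
  proof -
    have "continuous_on UNIV (\<lambda>t. f'' (x + t *\<^sub>R w) w w)"
      using C2_D3[OF f, of w w]
      by (rule continuous_on_compose2) (auto intro!: continuous_intros)
    then show ?thesis by (simp add: continuous_on_eq_continuous_at)
  qed
  then have "\<forall>\<^sub>F t in at 0. f'' (x + t *\<^sub>R w) w w > 0"
    using pos unfolding continuous_at by (intro order_tendstoD(1)) auto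
  then obtain d where d': "d > 0" "\<And>t. t \<noteq> 0 \<Longrightarrow> dist t 0 < d \<Longrightarrow> f'' (x + t *\<^sub>R w) w w > 0"
    unfolding eventually_at by auto
  define t where "t = min d \<rho> / 2"
  have t: "t > 0" "t < d" "t < \<rho>" using d'(1) \<rho> by (auto simp: t_def min_def)
  have "f (x + t *\<^sub>R w) > f x"
  proof (rule C2_increase[OF f d t(1)])
    fix s assume "0 \<le> s" "s \<le> t"
    then show "f'' (x + s *\<^sub>R w) w w > 0" using d'(2)[of s] t pos by (cases "s = 0") auto
  qed
  with t that show ?thesis by blast
qed

section \<open>Connectedness of superlevel sets near a boundary point\<close>

lemma connected_if_attached:
  assumes G: "connected G" "G \<noteq> {}" "G \<subseteq> S"
    and A: "\<And>y. y \<in> S \<Longrightarrow> \<exists>A. connected A \<and> A \<subseteq> S \<and> y \<in> A \<and> A \<inter> G \<noteq> {}"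
  shows "connected S"
proof -
  define F where "F = {G \<union> A | A. connected A \<and> A \<subseteq> S \<and> A \<inter> G \<noteq> {}}"
  have "connected (\<Union>F)"
  proof (rule connected_Union)
    show "connected B" if "B \<in> F" for B
      using that G by (auto simp: F_def intro!: connected_Un)
    have "G \<subseteq> \<Inter>F" by (auto simp: F_def)
    then show "\<Inter>F \<noteq> {}" using G by blast
  qed
  moreover have "\<Union>F = S"
  proof
    show "\<Union>F \<subseteq> S" using G by (auto simp: F_def)
    show "S \<subseteq> \<Union>F"
    proof
      fix y assume "y \<in> S"
      from A[OF this] show "y \<in> \<Union>F" unfolding F_def by blast
    qed
  qed
  ultimately show ?thesis by simp
qed

text \<open>\<open>C\<close> is a connected rim of the small convex set \<open>D\<close>. By
  compactness a whole neighbourhood of \<open>x + C\<close> lies above level \<open>c\<close>, and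
  \<open>G\<close>, the rim thickened by a small ball, is a connected set inside it. By
  \<open>push\<close>, each point of the thickened \<open>D\<close> above the level is joined to
  \<open>G\<close> by a segment that stays above it.\<close>

lemma locally_connected_superlevel_collar:
  fixes f :: "'a::real_normed_vector \<Rightarrow> real"
  assumes f: "continuous_on UNIV f" and \<rho>: "\<rho> > 0"
    and C: "compact C" "connected C" "C \<noteq> {}" "C \<subseteq> D" and D: "convex D" "0 \<in> D" "D \<subseteq> ball 0 (\<rho>/2)"
    and collar: "\<And>u. u \<in> C \<Longrightarrow> f (x + u) > c"
    and push: "\<And>d b. \<lbrakk>d \<in> D; norm b < \<rho>/2; f (x + b + d) > c\<rbrakk> \<Longrightarrow>
      \<exists>u\<in>C. \<forall>y\<in>closed_segment d u. f (x + b + y) > c"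
  shows "\<exists>N \<sigma>. \<sigma> > 0 \<and> ball x \<sigma> \<subseteq> N \<and> N \<subseteq> ball x \<rho> \<and> connected {y \<in> N. f y > c}"
proof -
  have "compact ((+) x ` C)" using C by (simp add: compact_translation)
  moreover have "open {y. f y > c}" using f by (intro open_Collect_less) auto
  moreover have "(+) x ` C \<subseteq> {y. f y > c}" using collar by auto
  ultimately obtain \<eta> where \<eta>: "\<eta> > 0" "(\<Union>y\<in>(+) x ` C. ball y \<eta>) \<subseteq> {y. f y > c}"
    by (rule compact_subset_open_imp_ball_epsilon_subset)
  define \<sigma> where "\<sigma> = min \<eta> (\<rho>/2)"
  have \<sigma>: "\<sigma> > 0" "\<sigma> \<le> \<eta>" "\<sigma> \<le> \<rho>/2" using \<eta>(1) \<rho> by (auto simp: \<sigma>_def)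
  define N where "N = (\<lambda>(b, d). x + b + d) ` (ball 0 \<sigma> \<times> D)"
  define G where "G = (\<lambda>(b, d). x + b + d) ` (ball 0 \<sigma> \<times> C)"
  have "connected G"
    unfolding G_def case_prod_unfold using C
    by (intro connected_continuous_image connected_Times continuous_intros) auto
  moreover have "G \<noteq> {}" using C(3) \<sigma>(1) by (auto simp: G_def)
  moreover have "G \<subseteq> {y \<in> N. f y > c}"
  proof
    fix y assume "y \<in> G"
    then obtain b u where bu: "norm b < \<sigma>" "u \<in> C" "y = x + b + u" by (auto simp: G_def)
    have "y \<in> ball (x + u) \<eta>"
      using bu \<sigma> by (simp add: dist_norm norm_minus_commute)
    then have "f y > c" using \<eta>(2) bu by blast
    moreover have "y \<in> N" using bu C(4) by (force simp: N_def)
    ultimately show "y \<in> {y \<in> N. f y > c}" by simp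
  qed
  moreover have "\<exists>A. connected A \<and> A \<subseteq> {y \<in> N. f y > c} \<and> y \<in> A \<and> A \<inter> G \<noteq> {}"
    if y: "y \<in> {y \<in> N. f y > c}" for y
  proof -
    obtain b d where bd: "norm b < \<sigma>" "d \<in> D" "y = x + b + d" using y by (auto simp: N_def)
    obtain u where u: "u \<in> C" "\<forall>y\<in>closed_segment d u. f (x + b + y) > c"
      using push[of d b] bd y \<sigma> by auto
    have "closed_segment d u \<subseteq> D" using u bd D(1) C(4) by (intro closed_segment_subset) auto
    then have "(\<lambda>v. x + b + v) ` closed_segment d u \<subseteq> N" using bd(1) by (force simp: N_def)
    moreover have "x + b + u \<in> G" using u bd by (force simp: G_def)
    moreover have "connected ((\<lambda>v. x + b + v) ` closed_segment d u)"
      by (intro connected_continuous_image continuous_intros) simp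
    ultimately show ?thesis
      using u(2) bd(3) by (intro exI[of _ "(\<lambda>v. x + b + v) ` closed_segment d u"]) auto
  qed
  ultimately have "connected {y \<in> N. f y > c}" by (rule connected_if_attached)
  moreover have "ball x \<sigma> \<subseteq> N"
  proof
    fix y assume "y \<in> ball x \<sigma>"
    then have "(y - x, 0) \<in> ball 0 \<sigma> \<times> D" using D(2) by (simp add: dist_norm norm_minus_commute)
    then show "y \<in> N" unfolding N_def by (rule rev_image_eqI) simp
  qed
  moreover have "N \<subseteq> ball x \<rho>"
  proof
    fix y assume "y \<in> N"
    then obtain b d where bd: "norm b < \<sigma>" "d \<in> D" "y = x + b + d" by (auto simp: N_def)
    have "norm d < \<rho>/2" using D(3) bd by auto
    then have "norm (b + d) < \<rho>" using norm_triangle_ineq[of b d] bd \<sigma> by linarith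
    moreover have "dist x y = norm (b + d)"
      using norm_minus_commute[of x y] by (simp add: bd dist_norm add.assoc)
    ultimately show "y \<in> ball x \<rho>" by simp
  qed
  ultimately show ?thesis using \<sigma>(1) by blast
qed

text \<open>With a direction of ascent the rim can be a single point: near \<open>x\<close>, sliding
  along \<open>w\<close> never decreases \<open>f\<close>.\<close>

lemma locally_connected_superlevel_regular:
  fixes f :: "'a::real_normed_vector \<Rightarrow> real"
  assumes f: "C2 f f' f''" and v: "f' x v > 0" and \<rho>: "\<rho> > 0"
  shows "\<exists>N \<sigma>. \<sigma> > 0 \<and> ball x \<sigma> \<subseteq> N \<and> N \<subseteq> ball x \<rho> \<and> connected {y \<in> N. f y > f x}"
proof -
  have "open {y. f' y v > 0}" using C2_continuous1[OF f] by (intro open_Collect_less) auto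
  then obtain r where r: "r > 0" "ball x r \<subseteq> {y. f' y v > 0}"
    using v open_contains_ball by blast
  define \<rho>' where "\<rho>' = min r \<rho>"
  have \<rho>': "\<rho>' > 0" "\<rho>' \<le> r" "\<rho>' \<le> \<rho>" using r \<rho> by (auto simp: \<rho>'_def)
  have "v \<noteq> 0" using v linear_0[OF C2_linear1[OF f]] by auto
  \<comment> \<open>Length \<open>\<rho>' / 4\<close> together with
    \<open>norm b < \<rho>' / 2\<close> keeps all points that occur within distance \<open>r\<close>
    of \<open>x\<close>, where the derivative along \<open>w\<close> is positive.\<close>
  define w where "w = (\<rho>' / (4 * norm v)) *\<^sub>R v"
  have w: "norm w = \<rho>'/4" using \<rho>' \<open>v \<noteq> 0\<close> by (simp add: w_def)
  have w': "f' y w > 0" if "y \<in> ball x r" for y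
    using r that \<rho>' \<open>v \<noteq> 0\<close> by (auto simp: w_def linear_cmul[OF C2_linear1[OF f]])
  have mono: "f z \<le> f (z + s *\<^sub>R w)"
    if z: "\<And>q. 0 \<le> q \<Longrightarrow> q \<le> s \<Longrightarrow> z + q *\<^sub>R w \<in> ball x r" and s: "s \<ge> 0" for z s
  proof -
    have "f (z + 0 *\<^sub>R w) \<le> f (z + s *\<^sub>R w)"
      using C2_line(1)[OF f] w'[OF z] less_imp_le
      by (intro DERIV_nonneg_imp_nondecreasing[OF s, of "\<lambda>s. f (z + s *\<^sub>R w)"]) blast
    then show ?thesis by simp
  qed
  have "\<exists>N \<sigma>. \<sigma> > 0 \<and> ball x \<sigma> \<subseteq> N \<and> N \<subseteq> ball x \<rho>' \<and> connected {y \<in> N. f y > f x}"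
  proof (rule locally_connected_superlevel_collar[where C="{w}" and D="closed_segment 0 w"])
    show "continuous_on UNIV f" using C2_continuous[OF f] .
    show "closed_segment 0 w \<subseteq> ball 0 (\<rho>'/2)"
      using w \<rho>' by (intro closed_segment_subset) auto
    fix u assume "u \<in> {w}"
    have "f (x + 0 *\<^sub>R w) < f (x + 1 *\<^sub>R w)"
    proof (rule DERIV_pos_imp_increasing[where f="\<lambda>s. f (x + s *\<^sub>R w)"])
      fix s :: real assume "0 \<le> s" "s \<le> 1"
      then have "norm (s *\<^sub>R w) \<le> 1 * norm w" unfolding norm_scaleR by (intro mult_right_mono) auto
      then have "norm (s *\<^sub>R w) < r" using w \<rho>' by linarith
      then have "x + s *\<^sub>R w \<in> ball x r" by (simp add: dist_norm)
      then show "\<exists>y. ((\<lambda>s. f (x + s *\<^sub>R w)) has_real_derivative y) (at s) \<and> 0 < y"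
        using C2_line(1)[OF f] w' by blast
    qed simp
    then show "f (x + u) > f x" using \<open>u \<in> {w}\<close> by simp
  next
    fix d b assume d: "d \<in> closed_segment 0 w" and b: "norm b < \<rho>'/2" and h: "f (x + b + d) > f x"
    obtain t where t: "0 \<le> t" "t \<le> 1" "d = t *\<^sub>R w" using d by (auto simp: closed_segment_def)
    have "f (x + b + y) > f x" if y: "y \<in> closed_segment d w" for y
    proof -
      obtain u where u: "0 \<le> u" "u \<le> 1" "y = (1 - u) *\<^sub>R d + u *\<^sub>R w"
        using y unfolding closed_segment_def by blast
      define s where "s = u * (1 - t)"
      have "s \<le> 1 - t" unfolding s_def using u t by (intro mult_left_le_one_le) auto
      moreover have "x + b + y = (x + b + d) + s *\<^sub>R w"
        unfolding u(3) t(3) s_def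
        by (simp add: scaleR_left_diff_distrib left_diff_distrib right_diff_distrib)
      ultimately have s: "0 \<le> s" "t + s \<le> 1" "x + b + y = (x + b + d) + s *\<^sub>R w"
        using u t by (auto simp: s_def)
      have "f (x + b + d) \<le> f ((x + b + d) + s *\<^sub>R w)"
      proof (rule mono[OF _ s(1)])
        fix q assume q: "0 \<le> q" "q \<le> s"
        then have "norm ((t + q) *\<^sub>R w) \<le> 1 * norm w"
          unfolding norm_scaleR using t s by (intro mult_right_mono) auto
        then have "norm (b + (t + q) *\<^sub>R w) < r"
          using norm_triangle_ineq[of b "(t + q) *\<^sub>R w"] b w \<rho>' by linarith
        moreover have "dist x (x + b + d + q *\<^sub>R w) = norm (b + (t + q) *\<^sub>R w)"
          using norm_minus_commute[of x "x + b + d + q *\<^sub>R w"]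
          by (simp add: dist_norm t scaleR_left_distrib add.assoc)
        ultimately show "x + b + d + q *\<^sub>R w \<in> ball x r" by simp
      qed
      with h show ?thesis unfolding s(3) by linarith
    qed
    then show "\<exists>u\<in>{w}. \<forall>y\<in>closed_segment d u. f (x + b + y) > f x" by blast
  qed (use \<rho>' in auto)
  then show ?thesis using \<rho>'(3) by (meson order_trans subset_ball)
qed

text \<open>The rim is the image of a circle in the plane of \<open>v1\<close> and
  \<open>v2\<close>, connected because this plane has real dimension two. Near \<open>x\<close>,
  \<open>f\<close> is strictly convex along the plane and its translates, so from any point of the
  disc it increases towards one end of a suitable diameter. Transversally the Hessian may be
  degenerate or negative.\<close>

lemma locally_connected_superlevel_critical:
  fixes f :: "'a::real_normed_vector \<Rightarrow> real"
  assumes f: "C2 f f' f''" and crit: "\<And>v. f' x v = 0" and \<rho>: "\<rho> > 0"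
    and v: "f'' x v1 v1 > 0" "f'' x v2 v2 > 0" "f'' x v1 v2 + f'' x v2 v1 = 0"
  shows "\<exists>N \<sigma>. \<sigma> > 0 \<and> ball x \<sigma> \<subseteq> N \<and> N \<subseteq> ball x \<rho> \<and> connected {y \<in> N. f y > f x}"
proof -
  define L where "L a = Re a *\<^sub>R v1 + Im a *\<^sub>R v2" for a
  have L: "bounded_linear L"
    unfolding L_def
    by (intro bounded_linear_add bounded_linear_scaleR_const bounded_linear_Re bounded_linear_Im)
  have lin: "linear L" using L by (simp add: bounded_linear.linear)
  define m where "m = min (f'' x v1 v1) (f'' x v2 v2)"
  have m: "m > 0" using v by (simp add: m_def)
  \<comment> \<open>On \<open>G\<close> the diagonal terms exceed \<open>m/2\<close> and the
    symmetrised mixed term is smaller than \<open>m/2\<close> in absolute value, so the quadratic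
    form is at least \<open>(m/4) * (p\<^sup>2 + q\<^sup>2)\<close>.\<close>
  define G where "G = {y. f'' y v1 v1 > m/2} \<inter> {y. f'' y v2 v2 > m/2} \<inter>
    ({y. f'' y v1 v2 + f'' y v2 v1 > - (m/2)} \<inter> {y. f'' y v1 v2 + f'' y v2 v1 < m/2})"
  have "open G" unfolding G_def
    by (intro open_Int open_Collect_less continuous_on_add continuous_on_const C2_D3[OF f])
  moreover have "x \<in> G" using v m by (auto simp: G_def m_def)
  ultimately obtain r where r: "r > 0" "ball x r \<subseteq> G" using open_contains_ball by blast
  have pos: "f'' y (L a) (L a) > 0" if y: "y \<in> ball x r" and a: "a \<noteq> 0" for y a
  proof -
    have yG: "y \<in> G" using y r by blast
    define p q where "p = Re a" and "q = Im a"
    define \<gamma> where "\<gamma> = f'' y v1 v2 + f'' y v2 v1"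
    note l = C2_linear2_left[OF f] and r' = C2_linear2_right[OF f]
    have "f'' y (L a) (L a) = p\<^sup>2 * f'' y v1 v1 + (p * q) * \<gamma> + q\<^sup>2 * f'' y v2 v2"
      unfolding L_def \<gamma>_def p_def q_def
      by (simp add: linear_add[OF l] linear_add[OF r'] linear_cmul[OF l] linear_cmul[OF r']
        algebra_simps power2_eq_square)
    also have "\<dots> \<ge> p\<^sup>2 * (m/2) + (p * q) * \<gamma> + q\<^sup>2 * (m/2)"
    proof -
      have "f'' y v1 v1 \<ge> m/2" "f'' y v2 v2 \<ge> m/2" using yG by (auto simp: G_def)
      then have "p\<^sup>2 * (m/2) \<le> p\<^sup>2 * f'' y v1 v1" "q\<^sup>2 * (m/2) \<le> q\<^sup>2 * f'' y v2 v2"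
        by (intro mult_left_mono; simp)+
      then show ?thesis by linarith
    qed
    also have "p\<^sup>2 * (m/2) + (p * q) * \<gamma> + q\<^sup>2 * (m/2) \<ge> p\<^sup>2 * (m/2) - \<bar>p * q\<bar> * (m/2) + q\<^sup>2 * (m/2)"
    proof -
      have "- (m/2) < \<gamma>" "\<gamma> < m/2" using yG by (simp_all add: G_def \<gamma>_def)
      then have "\<bar>\<gamma>\<bar> \<le> m/2" by linarith
      then have "\<bar>(p * q) * \<gamma>\<bar> \<le> \<bar>p * q\<bar> * (m/2)"
        unfolding abs_mult[of "p * q"] by (intro mult_left_mono) auto
      then show ?thesis by linarith
    qed
    also have "p\<^sup>2 * (m/2) - \<bar>p * q\<bar> * (m/2) + q\<^sup>2 * (m/2) = (m/2) * (p\<^sup>2 + q\<^sup>2 - \<bar>p * q\<bar>)"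
      by (simp add: algebra_simps)
    also have "\<dots> \<ge> (m/2) * ((p\<^sup>2 + q\<^sup>2) / 2)"
    proof (rule mult_left_mono)
      have "0 \<le> (\<bar>p\<bar> - \<bar>q\<bar>)\<^sup>2" by simp
      then show "(p\<^sup>2 + q\<^sup>2) / 2 \<le> p\<^sup>2 + q\<^sup>2 - \<bar>p * q\<bar>"
        by (simp add: power2_diff abs_mult field_simps)
    qed (use m in simp)
    finally have "f'' y (L a) (L a) \<ge> (m/2) * ((p\<^sup>2 + q\<^sup>2) / 2)" by linarith
    moreover have "p\<^sup>2 + q\<^sup>2 > 0"
      using a by (simp add: p_def q_def complex_eq_iff sum_power2_gt_zero_iff)
    then have "(m/2) * ((p\<^sup>2 + q\<^sup>2) / 2) > 0" using m by simp
    ultimately show ?thesis by linarith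
  qed
  have increase: "f y > f z"
    if zy: "closed_segment z y \<subseteq> ball x r" "y = z + s *\<^sub>R L a" "s > 0" and a: "a \<noteq> 0" and d: "f' z (L a) \<ge> 0" for z y s a
    unfolding zy(2)
  proof (rule C2_increase[OF f d \<open>s > 0\<close>])
    fix q assume q: "0 \<le> q" "q \<le> s"
    have "z + q *\<^sub>R L a = (1 - q/s) *\<^sub>R z + (q/s) *\<^sub>R y"
      using zy(3) unfolding zy(2) by (simp add: scaleR_left_diff_distrib scaleR_right_distrib)
    then have "z + q *\<^sub>R L a \<in> closed_segment z y"
      using q zy(3) unfolding closed_segment_def by (intro CollectI exI[of _ "q/s"]) auto
    then show "f'' (z + q *\<^sub>R L a) (L a) (L a) > 0" using pos zy(1) a by blast
  qed
  define \<rho>' where "\<rho>' = min r \<rho>"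
  have \<rho>': "\<rho>' > 0" "\<rho>' \<le> r" "\<rho>' \<le> \<rho>" using r \<rho> by (auto simp: \<rho>'_def)
  obtain B where B: "B > 0" "\<And>a. norm (L a) \<le> norm a * B"
    using bounded_linear.pos_bounded[OF L] by blast
  define \<epsilon> where "\<epsilon> = \<rho>' / (4 * B)"
  have \<epsilon>: "\<epsilon> > 0" using \<rho>' B by (simp add: \<epsilon>_def)
  have small: "norm (L a) < \<rho>'/2" if "norm a \<le> \<epsilon>" for a
  proof -
    have "norm (L a) \<le> \<epsilon> * B" using B(2)[of a] that B(1) mult_right_mono[of "norm a" \<epsilon> B] by linarith
    also have "\<dots> = \<rho>'/4" using B by (simp add: \<epsilon>_def)
    finally show ?thesis using \<rho>' by linarith
  qed
  have "\<exists>N \<sigma>. \<sigma> > 0 \<and> ball x \<sigma> \<subseteq> N \<and> N \<subseteq> ball x \<rho>' \<and> connected {y \<in> N. f y > f x}"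
  proof (rule locally_connected_superlevel_collar[where C="L ` sphere 0 \<epsilon>" and D="L ` cball 0 \<epsilon>"])
    show "continuous_on UNIV f" using C2_continuous[OF f] .
    have cont: "continuous_on S L" for S
      using L by (simp add: linear_continuous_on)
    show "compact (L ` sphere 0 \<epsilon>)" "connected (L ` sphere 0 \<epsilon>)"
      using cont by (auto intro!: compact_continuous_image connected_continuous_image connected_sphere)
    show "L ` sphere 0 \<epsilon> \<noteq> {}" using \<epsilon> by simp
    show "L ` sphere 0 \<epsilon> \<subseteq> L ` cball 0 \<epsilon>" by (intro image_mono) auto
    show "convex (L ` cball 0 \<epsilon>)" using convex_linear_image[OF lin] by simp
    show "0 \<in> L ` cball 0 \<epsilon>" using \<epsilon> linear_0[OF lin] by (intro image_eqI[of _ _ 0]) auto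
    show "L ` cball 0 \<epsilon> \<subseteq> ball 0 (\<rho>'/2)" using small by auto
    have seg: "closed_segment (x + b + L a) (x + b + L a') \<subseteq> ball x r"
      if "norm b < \<rho>'/2" "norm a \<le> \<epsilon>" "norm a' \<le> \<epsilon>" for b a a'
    proof (rule closed_segment_subset)
      have "x + b + L a \<in> ball x r" if "norm a \<le> \<epsilon>" for a
        using small[OF that] \<open>norm b < \<rho>'/2\<close> norm_triangle_ineq[of b "L a"] \<rho>'
          norm_minus_commute[of x "x + b + L a"]
        by (simp add: dist_norm add.assoc)
      then show "x + b + L a \<in> ball x r" "x + b + L a' \<in> ball x r" using that by auto
    qed simp
    show "f (x + u) > f x" if u: "u \<in> L ` sphere 0 \<epsilon>" for u
    proof -
      obtain a where a: "u = L a" "norm a = \<epsilon>" using u by auto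
      show ?thesis
        using seg[of 0 0 a] \<rho>' \<epsilon> a crit linear_0[OF lin] by (intro increase[of x "x + u" 1 a]) auto
    qed
    fix d b assume d: "d \<in> L ` cball 0 \<epsilon>" and b: "norm b < \<rho>'/2" and h: "f (x + b + d) > f x"
    obtain a where a: "d = L a" "norm a \<le> \<epsilon>" using d by auto
    obtain c where c: "norm c = \<epsilon>" "a = (norm a / \<epsilon>) *\<^sub>R c"
    proof (cases "a = 0")
      case True
      then show ?thesis using that[of "of_real \<epsilon>"] \<epsilon> by simp
    next
      case False
      then show ?thesis using that[of "(\<epsilon> / norm a) *\<^sub>R a"] \<epsilon> by simp
    qed
    \<comment> \<open>\<open>c\<close> and \<open>- c\<close> are the ends of a diameter through
      \<open>a\<close>. By linearity the derivative is nonnegative towards at least one of them, and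
      convexity then makes \<open>f\<close> increase all the way to the rim. The remaining way from
      \<open>a\<close> to \<open>c'\<close> is \<open>k *\<^sub>R c'\<close>.\<close>
    define c' where "c' = (if f' (x + b + d) (L c) \<ge> 0 then c else - c)"
    have c': "norm c' = \<epsilon>" using c by (simp add: c'_def)
    have d': "f' (x + b + d) (L c') \<ge> 0"
      by (auto simp: c'_def linear_neg[OF lin] linear_neg[OF C2_linear1[OF f]])
    define k where "k = (if f' (x + b + d) (L c) \<ge> 0 then 1 - norm a / \<epsilon> else 1 + norm a / \<epsilon>)"
    have k: "k \<ge> 0" using a \<epsilon> by (auto simp: k_def)
    have c'a: "c' - a = k *\<^sub>R c'"
      by (subst c(2)) (simp add: c'_def k_def scaleR_left_diff_distrib scaleR_left_distrib)
    have Lc: "L c' = d + k *\<^sub>R L c'"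
      using c'a linear_diff[OF lin, of c' a] linear_cmul[OF lin, of k c'] by (simp add: a)
    have "f (x + b + y) > f x" if y: "y \<in> closed_segment d (L c')" for y
    proof -
      obtain u where u: "0 \<le> u" "u \<le> 1" "y = (1 - u) *\<^sub>R d + u *\<^sub>R L c'"
        using y unfolding closed_segment_def by blast
      have "y = d + u *\<^sub>R (L c' - d)" 
        unfolding u(3) by (simp add: scaleR_left_diff_distrib scaleR_diff_right)
      also have "L c' - d = k *\<^sub>R L c'" using Lc by (metis add_diff_cancel_left')
      finally have y': "y = d + (u * k) *\<^sub>R L c'" by simp
      show ?thesis
      proof (cases "u * k = 0")
        case True
        then have "y = d" unfolding y' by simp
        then show ?thesis using h by simp
      next
        case False
        then have "u * k > 0" using mult_nonneg_nonneg[OF u(1) k] by linarith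
        have "closed_segment (x + b + d) (x + b + L c') \<subseteq> ball x r"
          using seg[OF b a(2), of c'] c' a by simp
        moreover have "closed_segment (x + b + d) (x + b + y) \<subseteq> closed_segment (x + b + d) (x + b + L c')"
          using y by (intro closed_segment_subset) (auto simp: closed_segment_translation_eq)
        ultimately have "f (x + b + y) > f (x + b + d)"
          using \<open>u * k > 0\<close> y' d' c' \<epsilon> by (intro increase[of _ _ "u * k" c']) auto
        with h show ?thesis by simp
      qed
    qed
    then show "\<exists>u\<in>L ` sphere 0 \<epsilon>. \<forall>y\<in>closed_segment d u. f (x + b + y) > f x"
      using c' by (intro bexI[of _ "L c'"]) auto
  qed (use \<rho>' in auto)
  then show ?thesis using \<rho>'(3) by (meson order_trans subset_ball)
qed

section \<open>Tubes around complex hypersurfaces\<close>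

lemma inner_imaginary_scale: "(\<i> *s v) \<bullet> (\<i> *s w) = v \<bullet> (w :: complex ^ 'n)"
proof -
  have "(\<i> * a) \<bullet> (\<i> * b) = a \<bullet> b" for a b :: complex
    by (simp add: inner_complex_def)
  then show ?thesis by (simp add: inner_vec_def)
qed

lemma linear_imaginary_scale: "linear ((*s) \<i> :: complex ^ 'n \<Rightarrow> complex ^ 'n)"
proof (rule linearI)
  show "\<i> *s (x + y) = \<i> *s x + \<i> *s y" for x y :: "complex ^ 'n"
    by (rule vector_add_ldistrib)
  show "\<i> *s (c *\<^sub>R x) = c *\<^sub>R (\<i> *s x)" for c :: real and x :: "complex ^ 'n"
    unfolding vec_eq_iff by simp
qed

text \<open>Storing \<open>f v\<close> and \<open>g v\<close> in two coordinates gives an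
  endomorphism that misses a third coordinate direction, so it is not surjective and hence not
  injective. Linearity is meant over the reals, because the maps that later encode orthogonality are
  conjugate linear.\<close>

lemma common_kernel:
  fixes f g :: "complex ^ 'n \<Rightarrow> complex"
  assumes n: "CARD('n) \<ge> 3" and f: "linear f" and g: "linear g"
  obtains v where "v \<noteq> 0" "f v = 0" "g v = 0"
proof -
  obtain i :: 'n where True by simp
  have "card {i} < CARD('n)" using n by simp
  then obtain j where j: "j \<noteq> i"
    by (metis UNIV_eq_I insertI1 singletonI nat_neq_iff)
  have "card {i, j} < CARD('n)" using n j by simp
  then have "{i, j} \<noteq> UNIV" by auto
  then obtain k where k: "k \<noteq> i" "k \<noteq> j" by blast
  define L :: "complex ^ 'n \<Rightarrow> complex ^ 'n"
    where "L v = (\<chi> m. if m = i then f v else if m = j then g v else 0)" for v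
  have L: "linear L"
    by (rule linearI) (simp_all add: L_def vec_eq_iff linear_add[OF f] linear_add[OF g] linear_cmul[OF f] linear_cmul[OF g])
  have "\<not> surj L"
  proof
    assume "surj L"
    then obtain v where "axis k 1 = L v" by (metis surjD)
    then have "axis k 1 $ k = L v $ k" by simp
    then show False using k by (simp add: L_def)
  qed
  then have "\<not> inj L" using linear_injective_imp_surjective[OF L] by blast
  then obtain v where v: "v \<noteq> 0" "L v = 0"
    using L unfolding linear_injective_0[OF L] by blast
  then have "L v $ i = 0" "L v $ j = 0" by simp_all
  then show ?thesis using v(1) j that by (simp add: L_def)
qed

text \<open>Holomorphy enters through the complex linearity of \<open>P' z\<close> and a sign rule
  for \<open>P'' z\<close>. The latter makes the second derivatives along \<open>v\<close> and
  \<open>\<i> *s v\<close> cancel: the real and imaginary parts are harmonic on complex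
  lines.\<close>

definition holomorphic_C2 :: "(complex ^ 'n \<Rightarrow> complex) \<Rightarrow> (complex ^ 'n \<Rightarrow> complex ^ 'n \<Rightarrow> complex)
    \<Rightarrow> (complex ^ 'n \<Rightarrow> complex ^ 'n \<Rightarrow> complex ^ 'n \<Rightarrow> complex) \<Rightarrow> bool" where
  "holomorphic_C2 P P' P'' \<longleftrightarrow> C2 P P' P'' \<and> (\<forall>z v. P' z (\<i> *s v) = \<i> * P' z v) \<and>
     (\<forall>z w v. P'' z (\<i> *s w) (\<i> *s v) = - P'' z w v)"

lemma holomorphic_C2_const: "\<exists>P' P''. holomorphic_C2 (\<lambda>_. c) P' P''"
proof -
  have "holomorphic_C2 (\<lambda>_. c) (\<lambda>_ _. 0) (\<lambda>_ _ _. 0)"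
    unfolding holomorphic_C2_def using C2_const by (intro conjI) auto
  then show ?thesis by blast
qed

lemma holomorphic_C2_component: "\<exists>P' P''. holomorphic_C2 (\<lambda>z. z $ i) P' P''"
proof -
  have "C2 (\<lambda>z. z $ i) (\<lambda>_ z. z $ i) (\<lambda>_ _ _. 0 :: complex)"
    using C2_bounded_linear[OF bounded_linear_vec_nth] .
  then have "holomorphic_C2 (\<lambda>z. z $ i) (\<lambda>_ z. z $ i) (\<lambda>_ _ _. 0)"
    by (simp add: holomorphic_C2_def)
  then show ?thesis by blast
qed

lemma holomorphic_C2_add:
  assumes "\<exists>P' P''. holomorphic_C2 P P' P''" "\<exists>Q' Q''. holomorphic_C2 Q Q' Q''"
  shows "\<exists>R' R''. holomorphic_C2 (\<lambda>z. P z + Q z) R' R''"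
proof -
  obtain P' P'' Q' Q'' where h: "holomorphic_C2 P P' P''" "holomorphic_C2 Q Q' Q''"
    using assms by blast
  have "holomorphic_C2 (\<lambda>z. P z + Q z) (\<lambda>z v. P' z v + Q' z v) (\<lambda>z w v. P'' z w v + Q'' z w v)"
    using h C2_add[of P P' P'' Q Q' Q''] by (simp add: holomorphic_C2_def distrib_left)
  then show ?thesis by blast
qed

lemma holomorphic_C2_mult:
  assumes "\<exists>P' P''. holomorphic_C2 P P' P''" "\<exists>Q' Q''. holomorphic_C2 Q Q' Q''"
  shows "\<exists>R' R''. holomorphic_C2 (\<lambda>z. P z * Q z) R' R''"
proof -
  obtain P' P'' Q' Q'' where h: "holomorphic_C2 P P' P''" "holomorphic_C2 Q Q' Q''"
    using assms by blast
  have P: "C2 P P' P''" "\<And>z v. P' z (\<i> *s v) = \<i> * P' z v" "\<And>z w v. P'' z (\<i> *s w) (\<i> *s v) = - P'' z w v"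
    and Q: "C2 Q Q' Q''" "\<And>z v. Q' z (\<i> *s v) = \<i> * Q' z v" "\<And>z w v. Q'' z (\<i> *s w) (\<i> *s v) = - Q'' z w v"
    using h by (simp_all add: holomorphic_C2_def)
  have "holomorphic_C2 (\<lambda>z. P z * Q z) (\<lambda>z v. P z * Q' z v + P' z v * Q z)
    (\<lambda>z w v. P z * Q'' z w v + P' z w * Q' z v + (P' z v * Q' z w + P'' z w v * Q z))"
    unfolding holomorphic_C2_def
  proof (intro conjI allI)
    show "C2 (\<lambda>z. P z * Q z) (\<lambda>z v. P z * Q' z v + P' z v * Q z)
      (\<lambda>z w v. P z * Q'' z w v + P' z w * Q' z v + (P' z v * Q' z w + P'' z w v * Q z))"
      using P(1) Q(1) by (rule C2_mult)
    fix z w v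
    show "P z * Q' z (\<i> *s v) + P' z (\<i> *s v) * Q z = \<i> * (P z * Q' z v + P' z v * Q z)"
      unfolding P(2) Q(2) by (simp add: algebra_simps)
    have i: "(\<i> * a) * (\<i> * b) = - (a * b)" for a b :: complex
    proof -
      have "(\<i> * a) * (\<i> * b) = (\<i> * \<i>) * (a * b)" by (simp only: ac_simps)
      then show ?thesis by simp
    qed
    show "P z * Q'' z (\<i> *s w) (\<i> *s v) + P' z (\<i> *s w) * Q' z (\<i> *s v) +
        (P' z (\<i> *s v) * Q' z (\<i> *s w) + P'' z (\<i> *s w) (\<i> *s v) * Q z) =
      - (P z * Q'' z w v + P' z w * Q' z v + (P' z v * Q' z w + P'' z w v * Q z))"
      unfolding P(2,3) Q(2,3) i by simp
  qed
  then show ?thesis by blast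
qed

lemma holomorphic_C2_polynomial:
  assumes "complex_polynomial_function P"
  shows "\<exists>P' P''. holomorphic_C2 P P' P''"
proof -
  obtain A c where A: "finite A" and P: "P = (\<lambda>z. \<Sum>\<alpha>\<in>A. c \<alpha> * (\<Prod>i\<in>UNIV. (z $ i) ^ \<alpha> i))"
    using assms unfolding complex_polynomial_function_def by blast
  have power: "\<exists>P' P''. holomorphic_C2 (\<lambda>z :: complex ^ 'a. (z $ i) ^ k) P' P''" for i k
    by (induction k) (simp_all add: holomorphic_C2_const holomorphic_C2_mult holomorphic_C2_component)
  have monomial: "\<exists>P' P''. holomorphic_C2 (\<lambda>z :: complex ^ 'a. \<Prod>i\<in>S. (z $ i) ^ \<alpha> i) P' P''"
    if "finite S" for S \<alpha>
    using that by induction (simp_all add: holomorphic_C2_const holomorphic_C2_mult power)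
  show ?thesis
    using A unfolding P
    by induction (simp_all add: holomorphic_C2_const holomorphic_C2_mult holomorphic_C2_add monomial)
qed

text \<open>
  The vanishing sum is, up to a constant factor, the Levi form of \<open>D\<close> at \<open>x\<close> in the direction \<open>v\<close>.
\<close>

definition flat_along :: "(complex ^ 'n \<Rightarrow> complex ^ 'n \<Rightarrow> real) \<Rightarrow>
    (complex ^ 'n \<Rightarrow> complex ^ 'n \<Rightarrow> complex ^ 'n \<Rightarrow> real) \<Rightarrow> complex ^ 'n \<Rightarrow> complex ^ 'n \<Rightarrow> bool" where
  "flat_along D' D'' x v \<longleftrightarrow> D' x v = 0 \<and> D' x (\<i> *s v) = 0 \<and>
     D'' x v v + D'' x (\<i> *s v) (\<i> *s v) = 0"

text \<open>\<open>l\<close> is the derivative of \<open>P\<close> at \<open>x\<close>. On its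
  kernel the first derivative vanishes along \<open>v\<close> and \<open>\<i> *s v\<close>, as do
  the terms quadratic in \<open>Q'\<close>, and the terms with \<open>Q''\<close> cancel between
  these two directions.\<close>

lemma polynomial_tube_C2:
  fixes P :: "complex ^ 'n \<Rightarrow> complex"
  assumes "complex_polynomial_function P"
  obtains D' D'' where "C2 (\<lambda>z. \<delta>\<^sup>2 - (cmod (P z - a))\<^sup>2) D' D''"
    "\<And>x. \<exists>l :: complex ^ 'n \<Rightarrow> complex. linear l \<and> (\<forall>v. l v = 0 \<longrightarrow> flat_along D' D'' x v)"
proof -
  have "\<exists>Q' Q''. holomorphic_C2 (\<lambda>z. P z + (- a)) Q' Q''"
    by (intro holomorphic_C2_add holomorphic_C2_polynomial[OF assms] holomorphic_C2_const)
  then obtain Q' Q'' where Q: "holomorphic_C2 (\<lambda>z. P z - a) Q' Q''" by auto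
  then have C: "C2 (\<lambda>z. P z - a) Q' Q''" by (simp add: holomorphic_C2_def)
  let ?D' = "\<lambda>z v. 0 - ((P z - a) \<bullet> Q' z v + Q' z v \<bullet> (P z - a))"
  let ?D'' = "\<lambda>z w v. 0 - ((P z - a) \<bullet> Q'' z w v + Q' z w \<bullet> Q' z v + (Q' z v \<bullet> Q' z w + Q'' z w v \<bullet> (P z - a)))"
  have "C2 (\<lambda>z. \<delta>\<^sup>2 - (cmod (P z - a))\<^sup>2) ?D' ?D''"
    unfolding power2_norm_eq_inner by (intro C2_diff C2_const C2_inner C)
  moreover have "linear (Q' x)" for x using C2_linear1[OF C] .
  moreover have "flat_along ?D' ?D'' x v" if "Q' x v = 0" for x v
    using that Q by (simp add: flat_along_def holomorphic_C2_def)
  ultimately show ?thesis using that by blast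
qed

text \<open>All products of first derivatives vanish along \<open>v\<close> and
  \<open>\<i> *s v\<close>; the remaining second derivatives cancel for each factor
  separately.\<close>

lemma flat_along_mult:
  assumes "flat_along D1' D1'' x v" "flat_along D2' D2'' x v"
  shows "flat_along (\<lambda>z v. D1 z * D2' z v + D1' z v * D2 z)
    (\<lambda>z w v. D1 z * D2'' z w v + D1' z w * D2' z v + (D1' z v * D2' z w + D1'' z w v * D2 z)) x v"
proof -
  have "D1'' x (\<i> *s v) (\<i> *s v) = - D1'' x v v" "D2'' x (\<i> *s v) (\<i> *s v) = - D2'' x v v"
    using assms by (simp_all add: flat_along_def)
  then show ?thesis using assms by (simp add: flat_along_def)
qed

section \<open>The weighted tube function and its Levi form\<close>

locale tube_weight =
  fixes D :: "complex ^ 'n \<Rightarrow> real" and D' D''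
  assumes D: "C2 D D' D''"
begin

definition \<psi> :: "complex ^ 'n \<Rightarrow> real" where
  "\<psi> z = (1 + z \<bullet> z) * D z"

definition \<psi>' :: "complex ^ 'n \<Rightarrow> complex ^ 'n \<Rightarrow> real" where
  "\<psi>' z v = (1 + z \<bullet> z) * D' z v + 2 * (z \<bullet> v) * D z"

definition \<psi>'' :: "complex ^ 'n \<Rightarrow> complex ^ 'n \<Rightarrow> complex ^ 'n \<Rightarrow> real" where
  "\<psi>'' z w v = (1 + z \<bullet> z) * D'' z w v + 2 * (z \<bullet> w) * D' z v + (2 * (z \<bullet> v) * D' z w + 2 * (w \<bullet> v) * D z)"

lemma C2_\<psi>: "C2 \<psi> \<psi>' \<psi>''"
proof -
  have id: "C2 (\<lambda>z. z) (\<lambda>_ z. z) (\<lambda>_ _ _. 0 :: complex ^ 'n)"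
    by (rule C2_bounded_linear) (simp add: bounded_linear_ident)
  have "C2 (\<lambda>z::complex ^ 'n. 1 + z \<bullet> z) (\<lambda>z v. 0 + (z \<bullet> v + v \<bullet> z)) (\<lambda>z w v. 0 + (z \<bullet> 0 + w \<bullet> v + (v \<bullet> w + 0 \<bullet> z)))"
    by (intro C2_add C2_const C2_inner id)
  then have "C2 (\<lambda>z::complex ^ 'n. 1 + z \<bullet> z) (\<lambda>z v. 2 * (z \<bullet> v)) (\<lambda>z w v. 2 * (w \<bullet> v))"
    by (simp add: inner_commute)
  from C2_mult[OF this D] show ?thesis unfolding \<psi>_def \<psi>'_def \<psi>''_def .
qed

lemma weight_pos: "1 + z \<bullet> z > (0::real)"
  using inner_ge_zero[of z] by linarith

lemma \<psi>_pos_iff: "\<psi> z > 0 \<longleftrightarrow> D z > 0"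
  using weight_pos[of z] zero_less_mult_iff[of "1 + z \<bullet> z" "D z"] by (auto simp: \<psi>_def)

text \<open>Along a flat direction the second derivatives of \<open>D\<close> cancel and the cross
  terms vanish with the first derivatives. Only the Hessian of \<open>z \<bullet> z\<close>
  survives, multiplied by \<open>D x\<close>; it contributes
  \<open>2 * (v \<bullet> v) * D x\<close> for each of \<open>v\<close> and
  \<open>\<i> *s v\<close>.\<close>

lemma levi_positive:
  assumes "flat_along D' D'' x v" "v \<noteq> 0" "\<psi> x > 0"
  shows "\<psi>'' x v v + \<psi>'' x (\<i> *s v) (\<i> *s v) > 0"
proof -
  have "D'' x (\<i> *s v) (\<i> *s v) = - D'' x v v" using assms by (simp add: flat_along_def)
  then have "\<psi>'' x v v + \<psi>'' x (\<i> *s v) (\<i> *s v) = 4 * (v \<bullet> v) * D x"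
    using assms by (simp add: \<psi>''_def flat_along_def inner_imaginary_scale)
  then show ?thesis using assms by (simp add: \<psi>_pos_iff)
qed

lemma obtain_positive_direction:
  assumes "flat_along D' D'' x v" "v \<noteq> 0" "\<psi> x > 0"
  obtains w where "w = v \<or> w = \<i> *s v" "\<psi>'' x w w > 0"
proof (cases "\<psi>'' x v v > 0")
  case True
  then show ?thesis using that by blast
next
  case False
  then have "\<psi>'' x (\<i> *s v) (\<i> *s v) > 0" using levi_positive[OF assms] by linarith
  then show ?thesis using that by blast
qed

text \<open>A maximum over \<open>closure C\<close> exceeds \<open>r\<close> and hence lies in the
  open set \<open>C\<close>. A direction of positive second derivative, oriented so that the first
  derivative is nonnegative, leads to a larger value.\<close>

lemma max_principle_\<psi>:
  assumes flat: "\<And>x. \<exists>v. v \<noteq> 0 \<and> flat_along D' D'' x v"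
    and C: "open C" "C \<noteq> {}" "bounded C" and r: "r \<ge> 0" "\<And>z. z \<in> C \<Longrightarrow> \<psi> z > r"
    and bd: "\<And>z. z \<in> closure C \<Longrightarrow> z \<notin> C \<Longrightarrow> \<psi> z \<le> r"
  shows False
proof -
  have "compact (closure C)" "closure C \<noteq> {}" using C by simp_all
  moreover have "continuous_on (closure C) \<psi>" using C2_continuous[OF C2_\<psi>] continuous_on_subset by blast
  ultimately obtain x where x: "x \<in> closure C" "\<And>y. y \<in> closure C \<Longrightarrow> \<psi> y \<le> \<psi> x"
    using continuous_attains_sup[of "closure C" \<psi>] by blast
  obtain c where c: "c \<in> C" using C by blast
  have "c \<in> closure C" using c closure_subset by blast
  then have "\<psi> x > r" using x(2)[of c] r(2)[OF c] by simp
  then have xC: "x \<in> C" using bd[OF x(1)] by force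
  obtain v where v: "v \<noteq> 0" "flat_along D' D'' x v" using flat by blast
  obtain w where w: "\<psi>'' x w w > 0"
    using obtain_positive_direction[OF v(2,1)] \<open>\<psi> x > r\<close> r(1) by force
  obtain u where u: "\<psi>'' x u u > 0" "\<psi>' x u \<ge> 0"
  proof (cases "\<psi>' x w \<ge> 0")
    case True
    then show ?thesis using that w by blast
  next
    case False
    have "\<psi>'' x (- w) (- w) = \<psi>'' x w w"
      using linear_neg[OF C2_linear2_left[OF C2_\<psi>, of x "- w"], of w]
        linear_neg[OF C2_linear2_right[OF C2_\<psi>, of x w], of w] by simp
    moreover have "\<psi>' x (- w) = - \<psi>' x w" using linear_neg[OF C2_linear1[OF C2_\<psi>]] .
    ultimately show ?thesis using that[of "- w"] w False by linarith
  qed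
  obtain d where d: "d > 0" "ball x d \<subseteq> C" using C(1) xC open_contains_ball by blast
  have u0: "u \<noteq> 0" using u(1) linear_0[OF C2_linear2_left[OF C2_\<psi>]] by auto
  obtain t where t: "t > 0" "t < d / norm u" "\<psi> (x + t *\<^sub>R u) > \<psi> x"
    using C2_ascent[OF C2_\<psi> u(2,1), of "d / norm u"] d u0 by auto
  have "x + t *\<^sub>R u \<in> ball x d" using t u0 by (simp add: dist_norm pos_less_divide_eq)
  then have "x + t *\<^sub>R u \<in> closure C" using d(2) closure_subset by blast
  then show False using x(2)[of "x + t *\<^sub>R u"] t(3) by simp
qed

lemma outward_ascent_\<psi>:
  fixes l :: "complex ^ 'n \<Rightarrow> complex"
  assumes n: "CARD('n) \<ge> 3" and l: "linear l" "\<And>v. l v = 0 \<Longrightarrow> flat_along D' D'' x v"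
    and x: "\<psi> x > 0" and \<rho>: "\<rho> > 0"
  shows "\<exists>y\<in>ball x \<rho>. \<psi> y > \<psi> x \<and> norm y > norm x"
proof -
  \<comment> \<open>\<open>p v = 0\<close> means Hermitian orthogonality to \<open>x\<close>.
    Whichever of \<open>v\<close> and \<open>\<i> *s v\<close> turns out to be the direction of
    ascent, it is orthogonal to \<open>x\<close>, and the norm grows by Pythagoras.\<close>
  define p where "p v = Complex (x \<bullet> v) (x \<bullet> (\<i> *s v))" for v
  have "linear p"
    by (rule linearI) (simp_all add: p_def complex_eq_iff inner_add_right
        linear_add[OF linear_imaginary_scale] linear_cmul[OF linear_imaginary_scale])
  then obtain v where v: "v \<noteq> 0" "l v = 0" "p v = 0" using common_kernel[OF n l(1)] by blast
  then have orth: "x \<bullet> v = 0" "x \<bullet> (\<i> *s v) = 0" by (simp_all add: p_def complex_eq_iff)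
  note flat = l(2)[OF v(2)]
  obtain w where w: "w = v \<or> w = \<i> *s v" "\<psi>'' x w w > 0"
    using obtain_positive_direction[OF flat v(1) x] .
  have "\<psi>' x w = 0" "x \<bullet> w = 0" using w(1) orth flat by (auto simp: \<psi>'_def flat_along_def)
  have w0: "w \<noteq> 0" using w(2) linear_0[OF C2_linear2_left[OF C2_\<psi>]] by auto
  obtain t where t: "t > 0" "t < \<rho> / norm w" "\<psi> (x + t *\<^sub>R w) > \<psi> x"
    using C2_ascent[OF C2_\<psi> _ w(2), of "\<rho> / norm w"] \<open>\<psi>' x w = 0\<close> \<rho> w0 by auto
  have "(norm (x + t *\<^sub>R w))\<^sup>2 = (norm x)\<^sup>2 + t\<^sup>2 * (w \<bullet> w)"
    using \<open>x \<bullet> w = 0\<close> unfolding power2_norm_eq_inner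
    by (simp add: inner_add_left inner_add_right inner_commute[of w x] power2_eq_square)
  also have "\<dots> > (norm x)\<^sup>2" using t(1) w0 by simp
  finally have "norm (x + t *\<^sub>R w) > norm x" by (rule power_less_imp_less_base) simp
  moreover have "x + t *\<^sub>R w \<in> ball x \<rho>" using t w0 by (simp add: dist_norm pos_less_divide_eq)
  ultimately show ?thesis using t(3) by blast
qed

lemma locally_connected_superlevel_\<psi>:
  fixes l :: "complex ^ 'n \<Rightarrow> complex"
  assumes n: "CARD('n) \<ge> 3" and l: "linear l" "\<And>v. l v = 0 \<Longrightarrow> flat_along D' D'' x v"
    and x: "\<psi> x > 0" and \<rho>: "\<rho> > 0"
  shows "\<exists>N \<sigma>. \<sigma> > 0 \<and> ball x \<sigma> \<subseteq> N \<and> N \<subseteq> ball x \<rho> \<and> connected {y \<in> N. \<psi> y > \<psi> x}"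
proof (cases "\<forall>v. \<psi>' x v = 0")
  case False
  then obtain v where "\<psi>' x v \<noteq> 0" by blast
  then have "\<psi>' x v > 0 \<or> \<psi>' x (- v) > 0" using linear_neg[OF C2_linear1[OF C2_\<psi>]] by force
  then show ?thesis using locally_connected_superlevel_regular[OF C2_\<psi> _ \<rho>] by blast
next
  case True
  obtain v where v: "v \<noteq> 0" "l v = 0" using common_kernel[OF n l(1) l(1)] by blast
  obtain v1 where v1: "\<psi>'' x v1 v1 > 0"
    using obtain_positive_direction[OF l(2)[OF v(2)] v(1) x] by blast
  \<comment> \<open>\<open>S\<close> pairs \<open>v1\<close> with a direction through the
    symmetrised Hessian. It is made to vanish at both \<open>u\<close> and \<open>\<i> *s u\<close>,
    since it is not known in advance which of the two has positive second derivative.\<close>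
  define S where "S w = \<psi>'' x v1 w + \<psi>'' x w v1" for w
  have S: "linear S" unfolding S_def
    by (intro linear_compose_add C2_linear2_left[OF C2_\<psi>] C2_linear2_right[OF C2_\<psi>])
  define p where "p w = Complex (S w) (S (\<i> *s w))" for w
  have "linear p"
    by (rule linearI) (simp_all add: p_def complex_eq_iff linear_add[OF S] linear_cmul[OF S]
        linear_add[OF linear_imaginary_scale] linear_cmul[OF linear_imaginary_scale])
  then obtain u where u: "u \<noteq> 0" "l u = 0" "p u = 0" using common_kernel[OF n l(1)] by blast
  obtain v2 where v2: "v2 = u \<or> v2 = \<i> *s u" "\<psi>'' x v2 v2 > 0"
    using obtain_positive_direction[OF l(2)[OF u(2)] u(1) x] .
  have "S v2 = 0" using u(3) v2(1) by (auto simp: p_def complex_eq_iff)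
  then show ?thesis
    using locally_connected_superlevel_critical[OF C2_\<psi> _ \<rho> v1 v2(2)] True by (simp add: S_def)
qed

end

text \<open>The map \<open>?h\<close> pushes points radially out to the sphere of radius
  \<open>r\<close> and fixes everything beyond it, so the exterior is a retract of the punctured
  space.\<close>

lemma simply_connected_exterior:
  assumes "3 \<le> DIM('a::euclidean_space)" and r: "r > 0"
  shows "simply_connected {z::'a. norm z \<ge> r}"
proof -
  let ?h = "\<lambda>z::'a. max 1 (r / norm z) *\<^sub>R z"
  have h: "norm (?h z) \<ge> r" if "z \<noteq> 0" for z
    using that r by (auto simp: max_def field_simps)
  have id: "?h z = z" if "norm z \<ge> r" for z
  proof -
    have "r / norm z \<le> 1" using that r by (simp add: divide_le_eq_1)
    then show ?thesis by (simp add: max_absorb1)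
  qed
  show ?thesis
  proof (rule simply_connected_retraction_gen[where S="- {0}" and h="?h" and k="\<lambda>z. z"])
    show "simply_connected (- {0::'a})" using simply_connected_punctured_universe[OF assms(1)] .
    show "continuous_on (- {0}) ?h" by (intro continuous_intros) auto
    show "?h ` (- {0}) = {z. norm z \<ge> r}"
    proof
      show "{z. norm z \<ge> r} \<subseteq> ?h ` (- {0})"
      proof
        fix z :: 'a assume z: "z \<in> {z. norm z \<ge> r}"
        then have "z \<noteq> 0" using r by auto
        then show "z \<in> ?h ` (- {0})" using id[of z] z by (intro image_eqI[of _ _ z]) auto
      qed
    qed (use h in auto)
  qed (use r id in auto)
qed

theorem theorem1:
  fixes K :: "(complex ^ 'n) set"
  assumes "CARD('n) \<ge> 3"
    and "compact K"
    and "rationally_convex K"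
  shows "simply_connected (- K)"
proof -
  note n = assms(1)
  define X where "X = - K"
  have "bounded K" using assms(2) compact_imp_bounded by blast
  then obtain R' where R': "R' > 0" "\<And>z. z \<in> K \<Longrightarrow> norm z < R'"
    unfolding bounded_pos_less by blast
  define R where "R = R' + 1"
  obtain b :: "complex ^ 'n" where b: "b \<in> Basis" using nonempty_Basis by blast
  \<comment> \<open>The base point has norm exactly \<open>R'\<close>: it lies in the closed
    exterior, which is simply connected and avoids \<open>K\<close>, while the section is built over
    the open exterior.\<close>
  define e where "e = R' *\<^sub>R b"
  have e: "norm e = R'" using b R' by (simp add: e_def)
  have "DIM(complex ^ 'n) \<ge> 3" using n by simp
  then have sc: "simply_connected {z :: complex ^ 'n. norm z \<ge> R'}"
    using simply_connected_exterior R'(1) by blast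
  obtain sE where sE: "path_section X e {z. norm z > R'} sE"
  proof (rule path_section_simply_connected[OF sc, of X e "{z. norm z > R'}"])
    show "{z. norm z \<ge> R'} \<subseteq> X" using R'(2) by (force simp: X_def)
    show "open {z :: complex ^ 'n. norm z > R'}" by (intro open_Collect_less continuous_intros)
  qed (use e that in auto)

  \<comment> \<open>A section over a tube around each point\<close>
  have tube: "\<exists>D D' D'' s. y \<in> {z. D z > 0} \<and> C2 D D' D'' \<and>
      (\<forall>x. \<exists>l :: complex ^ 'n \<Rightarrow> complex. linear l \<and> (\<forall>v. l v = 0 \<longrightarrow> flat_along D' D'' x v)) \<and>
      path_section X e {z. D z > 0} s \<and> (\<forall>z. D z > 0 \<longrightarrow> norm z > R \<longrightarrow> homotopic_paths X (s z) (sE z))"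
    if y: "y \<in> X" for y
  proof -
    obtain P where P: "complex_polynomial_function P" "P y = 1" "1 \<notin> P ` K"
      using assms(3) y unfolding rationally_convex_def X_def by blast
    obtain Q' Q'' where "holomorphic_C2 P Q' Q''" using holomorphic_C2_polynomial[OF P(1)] by blast
    then have "continuous_on UNIV P" unfolding holomorphic_C2_def using C2_continuous by blast
    then have "compact (P ` K)"
      using assms(2) compact_continuous_image continuous_on_subset by blast
    then obtain \<delta> where \<delta>: "\<delta> > 0" "\<And>w. w \<in> P ` K \<Longrightarrow> \<delta> \<le> dist 1 w"
      using separate_point_closed[of "P ` K" 1] P(3) compact_imp_closed by blast
    define D where "D z = \<delta>\<^sup>2 - (cmod (P z - 1))\<^sup>2" for z
    obtain D' D'' where D: "C2 D D' D''"
      and l: "\<And>x. \<exists>l :: complex ^ 'n \<Rightarrow> complex. linear l \<and> (\<forall>v. l v = 0 \<longrightarrow> flat_along D' D'' x v)"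
      using polynomial_tube_C2[OF P(1), of \<delta> 1] unfolding D_def[symmetric] by metis
    have yD: "D y > 0" using P(2) \<delta>(1) by (simp add: D_def)
    have DX: "{z. D z > 0} \<subseteq> X"
    proof
      fix z assume "z \<in> {z. D z > 0}"
      then have "cmod (P z - 1) < \<delta>" using \<delta>(1) by (auto simp: D_def intro: power_less_imp_less_base)
      then show "z \<in> X" using \<delta>(2)[of "P z"] by (force simp: X_def dist_norm norm_minus_commute)
    qed
    interpret tube_weight D D' D'' by unfold_locales fact
    have dir: "\<exists>v. v \<noteq> 0 \<and> flat_along D' D'' x v" for x
      using l[of x] common_kernel[OF n] by metis
    interpret ext: superlevel_extension X e \<psi> R R' sE
    proof
      show "continuous_on UNIV \<psi>" using C2_continuous[OF C2_\<psi>] .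
      show "{z. \<psi> z > 0} \<subseteq> X" using DX by (simp add: \<psi>_pos_iff)
      show "R' < R" by (simp add: R_def)
      show "path_section X e {z. norm z > R'} sE" by fact
      show False if "0 \<le> r" "open C" "C \<noteq> {}" "C \<subseteq> {z. r < \<psi> z}" "C \<subseteq> cball 0 R"
        "closure C \<inter> {z. r < \<psi> z} \<subseteq> C" for r C
        using that bounded_subset[OF bounded_cball that(5)]
        by (intro max_principle_\<psi>[OF dir, of C r]) force+
      fix x :: "complex ^ 'n" and \<rho> :: real assume x: "\<psi> x > 0" "\<rho> > 0"
      obtain lx :: "complex ^ 'n \<Rightarrow> complex" where lx: "linear lx" "\<And>v. lx v = 0 \<Longrightarrow> flat_along D' D'' x v"
        using l[of x] by blast
      show "\<exists>N \<sigma>. \<sigma> > 0 \<and> ball x \<sigma> \<subseteq> N \<and> N \<subseteq> ball x \<rho> \<and> connected {y \<in> N. \<psi> y > \<psi> x}"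
        using locally_connected_superlevel_\<psi>[OF n lx x] .
      show "\<exists>y\<in>ball x \<rho>. \<psi> y > \<psi> x \<and> norm y > norm x"
        using outward_ascent_\<psi>[OF n lx x] .
    qed
    obtain s where "ext.extends_to 0 s" using ext.section_extends .
    then have "path_section X e {z. D z > 0} s"
      "\<forall>z. D z > 0 \<longrightarrow> norm z > R \<longrightarrow> homotopic_paths X (s z) (sE z)"
      unfolding ext.extends_to_def \<psi>_pos_iff by blast+
    with yD D l show ?thesis by blast
  qed
  \<comment> \<open>A tube is remembered only through the smoothness and flatness of its function
    \<open>D\<close>; the comparison of two tubes runs on these alone.\<close>
  define F where "F = {({z. D z > 0}, s) | D s D' D''. C2 D D' D'' \<and>
      (\<forall>x. \<exists>l :: complex ^ 'n \<Rightarrow> complex. linear l \<and> (\<forall>v. l v = 0 \<longrightarrow> flat_along D' D'' x v)) \<and>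
      path_section X e {z. D z > 0} s \<and> (\<forall>z. D z > 0 \<longrightarrow> norm z > R \<longrightarrow> homotopic_paths X (s z) (sE z))}"
  have F: "path_section X e U s" if "(U, s) \<in> F" for U s
    using that by (auto simp: F_def)

  \<comment> \<open>Agreement of the sections over two tubes\<close>
  have agree: "homotopic_paths X (s1 y) (s2 y)"
    if h: "(U1, s1) \<in> F" "(U2, s2) \<in> F" "y \<in> U1" "y \<in> U2" for U1 s1 U2 s2 y
  proof (rule ccontr)
    assume not: "\<not> homotopic_paths X (s1 y) (s2 y)"
    obtain D1 D1' D1'' where D1: "U1 = {z. D1 z > 0}" "C2 D1 D1' D1''"
      "\<And>x. \<exists>l :: complex ^ 'n \<Rightarrow> complex. linear l \<and> (\<forall>v. l v = 0 \<longrightarrow> flat_along D1' D1'' x v)"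
      "\<And>z. D1 z > 0 \<Longrightarrow> norm z > R \<Longrightarrow> homotopic_paths X (s1 z) (sE z)"
      using h(1) unfolding F_def by blast
    obtain D2 D2' D2'' where D2: "U2 = {z. D2 z > 0}" "C2 D2 D2' D2''"
      "\<And>x. \<exists>l :: complex ^ 'n \<Rightarrow> complex. linear l \<and> (\<forall>v. l v = 0 \<longrightarrow> flat_along D2' D2'' x v)"
      "\<And>z. D2 z > 0 \<Longrightarrow> norm z > R \<Longrightarrow> homotopic_paths X (s2 z) (sE z)"
      using h(2) unfolding F_def by blast
    define A where "A = {z \<in> U1 \<inter> U2. homotopic_paths X (s1 z) (s2 z)}"
    define C where "C = {z \<in> U1 \<inter> U2. \<not> homotopic_paths X (s1 z) (s2 z)}"
    have oA: "open A" and oC: "open C"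
      unfolding A_def C_def using path_section_agree_clopen[OF F[OF h(1)] F[OF h(2)]] by blast+
    have "A \<inter> closure C = {}"
      using oA by (subst open_Int_closure_eq_empty) (auto simp: A_def C_def)
    have "C \<subseteq> cball 0 R"
    proof
      fix z assume z: "z \<in> C"
      show "z \<in> cball 0 R"
      proof (rule ccontr)
        assume "z \<notin> cball 0 R"
        then have "homotopic_paths X (s1 z) (sE z)" "homotopic_paths X (s2 z) (sE z)"
          using D1 D2 z by (auto simp: C_def)
        then show False
          using z homotopic_paths_trans homotopic_paths_sym unfolding C_def by blast
      qed
    qed
    then have bC: "bounded C" using bounded_subset bounded_cball by blast
    interpret tube_weight "\<lambda>z. D1 z * D2 z" "\<lambda>z v. D1 z * D2' z v + D1' z v * D2 z"
      "\<lambda>z w v. D1 z * D2'' z w v + D1' z w * D2' z v + (D1' z v * D2' z w + D1'' z w v * D2 z)"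
      using C2_mult[OF D1(2) D2(2)] by unfold_locales
    have dir: "\<exists>v. v \<noteq> 0 \<and> flat_along (\<lambda>z v. D1 z * D2' z v + D1' z v * D2 z)
      (\<lambda>z w v. D1 z * D2'' z w v + D1' z w * D2' z v + (D1' z v * D2' z w + D1'' z w v * D2 z)) x v" for x
    proof -
      obtain l1 :: "complex ^ 'n \<Rightarrow> complex" where l1: "linear l1" "\<And>v. l1 v = 0 \<Longrightarrow> flat_along D1' D1'' x v"
        using D1(3) by blast
      obtain l2 :: "complex ^ 'n \<Rightarrow> complex" where l2: "linear l2" "\<And>v. l2 v = 0 \<Longrightarrow> flat_along D2' D2'' x v"
        using D2(3) by blast
      obtain v where "v \<noteq> 0" "l1 v = 0" "l2 v = 0" using common_kernel[OF n l1(1) l2(1)] .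
      then show ?thesis using flat_along_mult l1(2) l2(2) by blast
    qed
    show False
    proof (rule max_principle_\<psi>[OF dir oC _ bC order_refl])
      show "C \<noteq> {}" using not h by (auto simp: C_def)
      show "\<psi> z > 0" if "z \<in> C" for z
        using that by (simp add: \<psi>_pos_iff C_def D1(1) D2(1))
      fix z assume z: "z \<in> closure C" "z \<notin> C"
      \<comment> \<open>Both factors are nonnegative on \<open>closure C\<close>. This excludes
        points where both are negative and the product is positive, so leaving the intersection of
        the tubes forces one factor to be zero.\<close>
      have "closed {z. 0 \<le> D1 z \<and> 0 \<le> D2 z}"
        by (intro closed_Collect_conj closed_Collect_le continuous_on_const
            C2_continuous[OF D1(2)] C2_continuous[OF D2(2)])
      then have "closure C \<subseteq> {z. 0 \<le> D1 z \<and> 0 \<le> D2 z}"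
        by (intro closure_minimal) (auto simp: C_def D1(1) D2(1))
      moreover have "z \<notin> U1 \<inter> U2"
        using z \<open>A \<inter> closure C = {}\<close> by (auto simp: A_def C_def)
      ultimately have "D1 z = 0 \<or> D2 z = 0" using z D1(1) D2(1) by force
      then show "\<psi> z \<le> 0" by (auto simp: \<psi>_def)
    qed
  qed
  obtain t where t: "path_section X e (\<Union>(fst ` F)) t"
    using path_section_Union[of F X e] F agree by metis
  have "\<Union>(fst ` F) = X"
  proof
    show "\<Union>(fst ` F) \<subseteq> X" using t by (simp add: path_section_def)
    show "X \<subseteq> \<Union>(fst ` F)"
    proof
      fix y assume "y \<in> X"
      from tube[OF this] obtain U s where "(U, s) \<in> F" "y \<in> U" unfolding F_def by blast
      then show "y \<in> \<Union>(fst ` F)" by force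
    qed
  qed
  with t show ?thesis using simply_connected_if_path_section unfolding X_def by metis
qed

end
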